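(* Every tricycle graph $G$ satisfies $\operatorname{dgon}(G) = 6$.
   Context: A tricycle graph is a multigraph obtained as follows: start with three disjoint cycles $C_1,C_2,C_3$, each on at least $2$ vertices (a cycle on $2$ vertices is two vertices joined by two parallel edges); choose two distinct vertices $v_i^-,v_i^+\in V(C_i)$ on each; add the edges $v_1^+v_2^-$, $v_2^+v_3^-$, $v_3^+v_1^-$; add a new vertex $v_0$ and six edges joining $v_0$ to $v_1^-,v_1^+,v_2^-,v_2^+,v_3^-,v_3^+$; finally subdivide (at least once, arbitrarily) each of these six edges incident with $v_0$. Divisors on $G$ are formal $\mathbb{Z}$-combinations of vertices; principal divisors are $L_G y$ ($L_G$ the Laplacian, $y\in\mathbb{Z}^{V(G)}$); equivalence means differing by a principal divisor; the rank of $D$ is the largest $k$ such that $D-E$ is equivalent to an effective divisor for all effective $E$ of degree $k$; $\operatorname{dgon}(G)$ is the minimum degree of a rank-$1$ divisor. *)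

theory Defs
  imports Main "HOL-Library.Multiset"
begin

text \<open>
  Loopless undirected multigraphs: an edge is a two-element set of vertices, and parallel edges
  are recorded by multiplicity.
\<close>

record 'a multigraph =
  verts :: "'a set"
  edges :: "'a set multiset"

definition valence :: "'a multigraph \<Rightarrow> 'a \<Rightarrow> nat" where
  "valence G v = size {#e \<in># edges G. v \<in> e#}"

definition laplacian :: "'a multigraph \<Rightarrow> 'a \<Rightarrow> 'a \<Rightarrow> int" where
  "laplacian G u v =
     (if u = v then int (valence G v) else - int (count (edges G) {u, v}))"

text \<open>
  A divisor is a function to the integers that vanishes outside the vertex set.
\<close>

definition divisors :: "'a multigraph \<Rightarrow> ('a \<Rightarrow> int) set" where
  "divisors G = {D. \<forall>v. v \<notin> verts G \<longrightarrow> D v = 0}"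

definition effective_divisors :: "'a multigraph \<Rightarrow> ('a \<Rightarrow> int) set" where
  "effective_divisors G = {D \<in> divisors G. \<forall>v. D v \<ge> 0}"

definition div_degree :: "'a multigraph \<Rightarrow> ('a \<Rightarrow> int) \<Rightarrow> int" where
  "div_degree G D = (\<Sum>v\<in>verts G. D v)"

text \<open>
  The matrix-vector product of the Laplacian with \<open>y\<close>; only the values of \<open>y\<close> on the vertex set
  matter.
\<close>

definition principal_divisor :: "'a multigraph \<Rightarrow> ('a \<Rightarrow> int) \<Rightarrow> ('a \<Rightarrow> int)" where
  "principal_divisor G y =
     (\<lambda>u. if u \<in> verts G then (\<Sum>v\<in>verts G. laplacian G u v * y v) else 0)"

definition div_equiv :: "'a multigraph \<Rightarrow> ('a \<Rightarrow> int) \<Rightarrow> ('a \<Rightarrow> int) \<Rightarrow> bool" where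
  "div_equiv G D D' \<longleftrightarrow> (\<exists>y. (\<lambda>v. D v - D' v) = principal_divisor G y)"

text \<open>
  The maximum is over all integers. There are no effective divisors of degree \<open>-1\<close>, so the
  condition is vacuous for \<open>k = -1\<close>, and a divisor that is not equivalent to an effective one gets
  rank \<open>-1\<close>, as usual.
\<close>

definition div_rank :: "'a multigraph \<Rightarrow> ('a \<Rightarrow> int) \<Rightarrow> int" where
  "div_rank G D =
     (GREATEST k. \<forall>E \<in> effective_divisors G. div_degree G E = k \<longrightarrow>
        (\<exists>F \<in> effective_divisors G. div_equiv G (\<lambda>v. D v - E v) F))"

definition dgon :: "'a multigraph \<Rightarrow> int" where
  "dgon G = (LEAST d. \<exists>D \<in> divisors G. div_rank G D = 1 \<and> div_degree G D = d)"

fun path_edges :: "'a list \<Rightarrow> 'a set multiset" where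
  "path_edges (u # v # vs) = add_mset {u, v} (path_edges (v # vs))"
| "path_edges _ = {#}"

text \<open>
  The cycle through the vertices of a list in order; for \<open>[a, b]\<close> this is the edge \<open>{a, b}\<close> with
  multiplicity two.
\<close>

definition cycle_edges :: "'a list \<Rightarrow> 'a set multiset" where
  "cycle_edges vs = path_edges (vs @ [hd vs])"

text \<open>
  The three cycles are indexed by \<open>0, 1, 2\<close> instead of \<open>1, 2, 3\<close>, with \<open>C i\<close> listing the vertices
  of the \<open>i\<close>-th one and \<open>vm i\<close>, \<open>vp i\<close> being its chosen vertices $v_i^-$, $v_i^+$. The nonempty
  lists \<open>Pm i\<close> and \<open>Pp i\<close> consist of the new vertices subdividing the edges from \<open>v0\<close> to \<open>vm i\<close>
  and \<open>vp i\<close>: subdividing an edge replaces it by a path whose inner vertices are new.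
\<close>

definition tricycle_graph :: "'a multigraph \<Rightarrow> bool" where
  "tricycle_graph G \<longleftrightarrow>
     (\<exists>v0 C vm vp Pm Pp.
        (\<forall>i<3. length (C i) \<ge> 2 \<and> vm i \<in> set (C i) \<and> vp i \<in> set (C i) \<and> vm i \<noteq> vp i
               \<and> Pm i \<noteq> [] \<and> Pp i \<noteq> []) \<and>
        distinct (v0 # concat (map (\<lambda>i. C i @ Pm i @ Pp i) [0..<3])) \<and>
        verts G = insert v0 (\<Union>i<3. set (C i) \<union> set (Pm i) \<union> set (Pp i)) \<and>
        edges G =
          (\<Sum>i<3. cycle_edges (C i) + {#{vp i, vm ((i + 1) mod 3)}#}
                 + path_edges (v0 # Pm i @ [vm i]) + path_edges (v0 # Pp i @ [vp i])))"

end

theory Submission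
  imports Defs
begin

text \<open>
  For the lower bound, let \<open>R\<close> be a \<open>v0\<close>-reduced effective divisor of degree at most 5 in a
  class of positive rank. If the cycle \<open>C i\<close> carries at most one chip, then some hub \<open>vm i\<close> or
  \<open>vp i\<close> carries none, and the maximum set of the function that brings a chip there is a legal firing
  set \<open>U\<close> that contains \<open>v0\<close> but not this hub. The chips on \<open>C i\<close> do not suffice to separate its
  two hubs, and a cut has at most 5 edges, so \<open>U\<close> omits exactly the two hubs of \<open>C i\<close>. As the edges
  between different cycles are not subdivided, this forces chips on both of their outer ends, and two
  more chips on the two paths from \<open>v0\<close>. Since not all three cycles can carry two chips, this
  happens for at least one of them, hence for two of them, and then there are at least 6 chips.

  For the upper bound, put one chip on each of the six hubs. Two chips at the ends of a path can be
  moved towards each other, which covers the cycles. All six chips can be moved simultaneously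
  towards \<open>v0\<close> until the first one arrives; from then on the chip at \<open>v0\<close> and the chip on a longer
  path can be moved towards each other.
\<close>

section \<open>Laplacians and cuts as sums over edges\<close>

text \<open>The share of one edge in the entry of \<open>L y\<close> at \<open>u\<close>. Summing
  such shares makes the Laplacian additive in the edge multiset, so it can be computed piece by
  piece along paths and cycles.\<close>

definition edge_laplacian :: "('a \<Rightarrow> int) \<Rightarrow> 'a \<Rightarrow> 'a set \<Rightarrow> int" where
  "edge_laplacian y u e = (if u \<in> e then \<Sum>w\<in>e. y u - y w else 0)"

definition edges_laplacian :: "'a set multiset \<Rightarrow> ('a \<Rightarrow> int) \<Rightarrow> 'a \<Rightarrow> int" where
  "edges_laplacian A y u = (\<Sum>e\<in>#A. edge_laplacian y u e)"

text \<open>For a two-element edge, \<open>card (e - U)\<close> is 1 if the edge leaves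
  \<open>U\<close> at \<open>u\<close> and 0 otherwise, so a vertex \<open>u\<close> of
  \<open>U\<close> loses this many chips when \<open>U\<close> is fired. A set is legal for a
  divisor if every vertex holds at least that many chips.\<close>

definition out_degree :: "'a set multiset \<Rightarrow> 'a set \<Rightarrow> 'a \<Rightarrow> int" where
  "out_degree A U u = (\<Sum>e\<in>#A. if u \<in> e \<inter> U then int (card (e - U)) else 0)"

lemma edges_laplacian_simps [simp]:
  "edges_laplacian {#} y u = 0"
  "edges_laplacian (add_mset e A) y u = edge_laplacian y u e + edges_laplacian A y u"
  "edges_laplacian (A + B) y u = edges_laplacian A y u + edges_laplacian B y u"
  by (auto simp: edges_laplacian_def)

lemma out_degree_simps [simp]:
  "out_degree {#} U u = 0"
  "out_degree (A + B) U u = out_degree A U u + out_degree B U u"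
  by (auto simp: out_degree_def)

lemma edges_laplacian_sum:
  "edges_laplacian (\<Sum>i\<in>I. A i) y u = (\<Sum>i\<in>I. edges_laplacian (A i) y u)"
  by (induction I rule: infinite_finite_induct) auto

lemma out_degree_sum: "out_degree (\<Sum>i\<in>I. A i) U u = (\<Sum>i\<in>I. out_degree (A i) U u)"
  by (induction I rule: infinite_finite_induct) auto

lemma out_degree_nonneg: "out_degree A U u \<ge> 0"
  unfolding out_degree_def by (induction A) auto

lemma out_degree_eq_0: "u \<notin> U \<Longrightarrow> out_degree A U u = 0"
  by (simp add: out_degree_def)

lemma edge_laplacian_doubleton [simp]:
  "edge_laplacian y u {a, b} =
     (if a = b then 0 else (if u = a then y a - y b else 0) + (if u = b then y b - y a else 0))"
  by (auto simp: edge_laplacian_def)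

lemma edges_laplacian_const:
  assumes "\<And>e v. \<lbrakk>e \<in># A; v \<in> e\<rbrakk> \<Longrightarrow> y v = c"
  shows "edges_laplacian A y u = 0"
proof -
  have "edge_laplacian y u e = 0" if "e \<in># A" for e
    using assms[OF that] by (auto simp: edge_laplacian_def)
  then show ?thesis
    by (induction A) auto
qed

lemma edges_laplacian_add:
  "edges_laplacian A (\<lambda>v. x v + y v) u = edges_laplacian A x u + edges_laplacian A y u"
proof (induction A)
  case (add e A)
  have "edge_laplacian (\<lambda>v. x v + y v) u e = edge_laplacian x u e + edge_laplacian y u e"
    by (simp add: edge_laplacian_def sum.distrib[symmetric] algebra_simps)
  then show ?case
    using add by simp
qed simp

lemma edges_laplacian_uminus:
  "edges_laplacian A (\<lambda>v. - y v) u = - edges_laplacian A y u"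
proof (induction A)
  case (add e A)
  have "edge_laplacian (\<lambda>v. - y v) u e = - edge_laplacian y u e"
    by (simp add: edge_laplacian_def sum_negf[symmetric])
  then show ?case
    using add by simp
qed simp

lemma out_degree_mono:
  assumes "A \<subseteq># B"
  shows "out_degree A U u \<le> out_degree B U u"
proof -
  obtain C where "B = A + C"
    using assms by (auto simp: mset_subset_eq_exists_conv)
  then show ?thesis
    using out_degree_nonneg[of C U u] by simp
qed

section \<open>Equivalence of divisors on finite loopless multigraphs\<close>

locale finite_multigraph =
  fixes G :: "'a multigraph"
  assumes finite_verts [simp]: "finite (verts G)"
    and edges_card: "e \<in># edges G \<Longrightarrow> card e = 2"
    and edges_subset: "e \<in># edges G \<Longrightarrow> e \<subseteq> verts G"
begin

lemma principal_divisor_eq: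
  assumes "u \<in> verts G"
  shows "principal_divisor G y u = edges_laplacian (edges G) y u"
proof -
  let ?V = "verts G"
  \<comment> \<open>Stated for every multiset of edges over the fixed vertex set, so that edges can
    be added one at a time. Each edge at \<open>u\<close> adds \<open>y u\<close> through the
    valence and subtracts the value at its other end.\<close>
  have *: "int (size {#e \<in># A. u \<in> e#}) * y u - (\<Sum>v\<in>?V - {u}. int (count A {u, v}) * y v)
      = edges_laplacian A y u"
    if "\<forall>e\<in>#A. card e = 2 \<and> e \<subseteq> ?V" for A
    using that
  proof (induction A)
    case (add e A)
    then obtain a b where e: "e = {a, b}" "a \<noteq> b" "a \<in> ?V" "b \<in> ?V"
      by (auto simp: card_2_iff)
    have "(\<Sum>v\<in>?V - {u}. int (count (add_mset e A) {u, v}) * y v)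
        = (\<Sum>v\<in>?V - {u}. int (count A {u, v}) * y v)
          + (\<Sum>v\<in>?V - {u}. if e = {u, v} then y v else 0)"
      by (subst sum.distrib[symmetric], rule sum.cong) (auto simp: algebra_simps)
    also have "(\<Sum>v\<in>?V - {u}. if e = {u, v} then y v else 0)
        = (\<Sum>v\<in>?V - {u}. (if u = a \<and> v = b then y b else 0) + (if u = b \<and> v = a then y a else 0))"
      using e by (intro sum.cong) (auto simp: doubleton_eq_iff)
    also have "\<dots> = (if u = a then y b else 0) + (if u = b then y a else 0)"
      using e by (cases "u = a"; cases "u = b") (auto simp: sum.delta)
    finally show ?case
      using add e by (auto simp: algebra_simps)
  qed simp
  have "principal_divisor G y u
      = laplacian G u u * y u + (\<Sum>v\<in>?V - {u}. laplacian G u v * y v)"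
    using assms by (simp add: principal_divisor_def sum.remove)
  also have "(\<Sum>v\<in>?V - {u}. laplacian G u v * y v)
      = - (\<Sum>v\<in>?V - {u}. int (count (edges G) {u, v}) * y v)"
    unfolding sum_negf[symmetric] by (rule sum.cong) (auto simp: laplacian_def)
  finally show ?thesis
    using *[of "edges G"] edges_card edges_subset
    by (simp add: laplacian_def valence_def)
qed

text \<open>Divisors and principal divisors vanish outside the graph, so the comparison can be
  restricted to vertices.\<close>

lemma div_equiv_iff:
  assumes "D \<in> divisors G" "D' \<in> divisors G"
  shows "div_equiv G D D' \<longleftrightarrow>
    (\<exists>y. \<forall>u\<in>verts G. D u - D' u = edges_laplacian (edges G) y u)"
proof -
  have "(\<lambda>v. D v - D' v) = principal_divisor G y
      \<longleftrightarrow> (\<forall>u\<in>verts G. D u - D' u = edges_laplacian (edges G) y u)" for y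
  proof
    assume "(\<lambda>v. D v - D' v) = principal_divisor G y"
    then show "\<forall>u\<in>verts G. D u - D' u = edges_laplacian (edges G) y u"
      using principal_divisor_eq by metis
  next
    assume *: "\<forall>u\<in>verts G. D u - D' u = edges_laplacian (edges G) y u"
    show "(\<lambda>v. D v - D' v) = principal_divisor G y"
    proof
      fix v
      show "D v - D' v = principal_divisor G y v"
        using assms * principal_divisor_eq[of v y]
        by (cases "v \<in> verts G") (simp_all add: divisors_def principal_divisor_def)
    qed
  qed
  then show ?thesis
    by (simp add: div_equiv_def)
qed

lemma div_equiv_refl: "D \<in> divisors G \<Longrightarrow> div_equiv G D D"
  using div_equiv_iff[of D D] by (auto intro!: exI[of _ "\<lambda>v. 0"] simp: edges_laplacian_const[of _ _ 0])

lemma div_equiv_sym: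
  assumes "D \<in> divisors G" "D' \<in> divisors G" "div_equiv G D D'"
  shows "div_equiv G D' D"
proof -
  obtain y where "\<forall>u\<in>verts G. D u - D' u = edges_laplacian (edges G) y u"
    using assms(3) div_equiv_iff[OF assms(1,2)] by blast
  then have "\<forall>u\<in>verts G. D' u - D u = edges_laplacian (edges G) (\<lambda>v. - y v) u"
    by (auto simp: edges_laplacian_uminus)
  then show ?thesis
    using div_equiv_iff[OF assms(2,1)] by blast
qed

lemma div_equiv_trans:
  assumes "D \<in> divisors G" "D' \<in> divisors G" "D'' \<in> divisors G"
    and "div_equiv G D D'" "div_equiv G D' D''"
  shows "div_equiv G D D''"
proof -
  obtain y where "\<forall>u\<in>verts G. D u - D' u = edges_laplacian (edges G) y u"
    using assms(4) div_equiv_iff[OF assms(1,2)] by blast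
  moreover obtain y' where "\<forall>u\<in>verts G. D' u - D'' u = edges_laplacian (edges G) y' u"
    using assms(5) div_equiv_iff[OF assms(2,3)] by blast
  ultimately have "\<forall>u\<in>verts G. D u - D'' u = edges_laplacian (edges G) (\<lambda>v. y v + y' v) u"
    unfolding edges_laplacian_add by fastforce
  then show ?thesis
    using div_equiv_iff[OF assms(1,3)] by blast
qed

text \<open>The two ends of an edge receive opposite contributions.\<close>

lemma sum_edges_laplacian: "(\<Sum>u\<in>verts G. edges_laplacian (edges G) y u) = 0"
proof -
  have "(\<Sum>u\<in>verts G. edges_laplacian A y u) = 0" if "\<forall>e\<in>#A. card e = 2 \<and> e \<subseteq> verts G" for A
    using that
  proof (induction A)
    case (add e A)
    then obtain a b where "e = {a, b}" "a \<noteq> b" "a \<in> verts G" "b \<in> verts G"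
      by (auto simp: card_2_iff)
    then show ?case
      using add by (simp add: sum.distrib)
  qed simp
  then show ?thesis
    using edges_card edges_subset by blast
qed

lemma div_degree_equiv:
  assumes "D \<in> divisors G" "D' \<in> divisors G" "div_equiv G D D'"
  shows "div_degree G D = div_degree G D'"
proof -
  obtain y where "\<forall>u\<in>verts G. D u - D' u = edges_laplacian (edges G) y u"
    using assms(3) div_equiv_iff[OF assms(1,2)] by blast
  then have "(\<Sum>u\<in>verts G. D u - D' u) = 0"
    using sum_edges_laplacian by simp
  then show ?thesis
    by (simp add: div_degree_def sum_subtractf)
qed

text \<open>At a maximum of \<open>y\<close> no edge contributes negatively, and an edge leaving
  \<open>U\<close> contributes at least 1. Hence a vertex of the maximum set has no more edges
  leaving this set than the number of chips it loses under \<open>y\<close>.\<close>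

lemma out_degree_le_edges_laplacian:
  assumes "u \<in> U" and "\<And>v. v \<in> verts G \<Longrightarrow> v \<notin> U \<Longrightarrow> y v + 1 \<le> y u"
    and "\<And>v. v \<in> verts G \<Longrightarrow> y v \<le> y u"
  shows "out_degree (edges G) U u \<le> edges_laplacian (edges G) y u"
proof -
  have "(if u \<in> e \<inter> U then int (card (e - U)) else 0) \<le> edge_laplacian y u e"
    if e: "e \<in># edges G" for e
  proof -
    obtain a b where "e = {a, b}" "a \<noteq> b" "a \<in> verts G" "b \<in> verts G"
      using edges_card[OF e] edges_subset[OF e] by (auto simp: card_2_iff)
    then show ?thesis
      using assms(1) assms(2)[of a] assms(2)[of b] assms(3)[of a] assms(3)[of b]
      by (auto simp: insert_Diff_if)
  qed
  then show ?thesis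
    unfolding out_degree_def edges_laplacian_def by (intro sum_mset_mono) auto
qed

text \<open>Firing \<open>U\<close> costs a vertex of \<open>U\<close> exactly its out-degree, while
  a vertex outside \<open>U\<close> can only gain, which is why this is an inequality.\<close>

lemma edges_laplacian_indicator:
  "edges_laplacian (edges G) (\<lambda>v. if v \<in> U then 1 else 0) u \<le> out_degree (edges G) U u"
proof -
  have "edge_laplacian (\<lambda>v. if v \<in> U then 1 else 0) u e
      \<le> (if u \<in> e \<inter> U then int (card (e - U)) else 0)"
    if e: "e \<in># edges G" for e
  proof -
    obtain a b where "e = {a, b}" "a \<noteq> b"
      using edges_card[OF e] by (auto simp: card_2_iff)
    then show ?thesis
      by (auto simp: insert_Diff_if)
  qed
  then show ?thesis
    unfolding out_degree_def edges_laplacian_def by (intro sum_mset_mono) auto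
qed

lemma finite_effective_divisors: "finite {D \<in> effective_divisors G. div_degree G D = d}"
proof (rule finite_subset)
  show "finite {D. \<forall>v. (v \<in> verts G \<longrightarrow> D v \<in> {0..d}) \<and> (v \<notin> verts G \<longrightarrow> D v = 0)}"
    by (rule finite_set_of_finite_funs) auto
  show "{D \<in> effective_divisors G. div_degree G D = d}
      \<subseteq> {D. \<forall>v. (v \<in> verts G \<longrightarrow> D v \<in> {0..d}) \<and> (v \<notin> verts G \<longrightarrow> D v = 0)}"
    by (auto simp: effective_divisors_def divisors_def div_degree_def intro!: member_le_sum)
qed

end

section \<open>Reduced divisors\<close>

text \<open>\<open>y\<close> counts firings: \<open>v0\<close> never fires, but some vertex does.
  Excluding the zero function turns the relation into a strict order on a connected graph.\<close>

definition moves_toward :: "'a multigraph \<Rightarrow> 'a \<Rightarrow> ('a \<Rightarrow> int) \<Rightarrow> ('a \<Rightarrow> int) \<Rightarrow> bool" where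
  "moves_toward G v0 D D' \<longleftrightarrow>
     (\<exists>y. (\<forall>u\<in>verts G. D u - D' u = edges_laplacian (edges G) y u) \<and> y v0 = 0 \<and>
          (\<forall>u\<in>verts G. y u \<ge> 0) \<and> (\<exists>u\<in>verts G. y u \<noteq> 0))"

text \<open>Rank at least 1, expressed without the maximum in \<open>div_rank\<close>.\<close>

definition positive_rank :: "'a multigraph \<Rightarrow> ('a \<Rightarrow> int) \<Rightarrow> bool" where
  "positive_rank G D \<longleftrightarrow> (\<forall>E \<in> effective_divisors G. div_degree G E = 1 \<longrightarrow>
        (\<exists>F \<in> effective_divisors G. div_equiv G (\<lambda>v. D v - E v) F))"

lemma point_divisor:
  assumes "finite (verts G)" "q \<in> verts G" "k \<ge> 0"
  shows "(\<lambda>v. if v = q then k else 0) \<in> effective_divisors G"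
    "div_degree G (\<lambda>v. if v = q then k else 0) = k"
  using assms by (auto simp: effective_divisors_def divisors_def div_degree_def)

lemma effective_in_divisors: "D \<in> effective_divisors G \<Longrightarrow> D \<in> divisors G"
  by (simp add: effective_divisors_def)

lemma effective_of_degree_1:
  assumes "finite (verts G)" "E \<in> effective_divisors G" "div_degree G E = 1"
  obtains q where "q \<in> verts G" "E = (\<lambda>v. if v = q then 1 else 0)"
proof -
  have E: "E v \<ge> 0" "v \<notin> verts G \<Longrightarrow> E v = 0" for v
    using assms(2) by (auto simp: effective_divisors_def divisors_def)
  obtain q where q: "q \<in> verts G" "E q \<noteq> 0"
    using assms(3) unfolding div_degree_def by (metis sum.neutral zero_neq_one)
  have split: "E q + (\<Sum>v\<in>verts G - {q}. E v) = 1"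
    using assms(1,3) q(1) by (simp add: div_degree_def sum.remove)
  have "(\<Sum>v\<in>verts G - {q}. E v) \<ge> 0"
    using E by (intro sum_nonneg) auto
  then have "E q = 1" "(\<Sum>v\<in>verts G - {q}. E v) = 0"
    using split E(1)[of q] q(2) by linarith+
  then have "E v = 0" if "v \<noteq> q" for v
    using that E assms(1) by (cases "v \<in> verts G") (auto simp: sum_nonneg_eq_0_iff)
  then show thesis
    using q \<open>E q = 1\<close> by (intro that[of q]) auto
qed

context finite_multigraph
begin

text \<open>The firing functions add up, and being nonnegative they cannot cancel.\<close>

lemma moves_toward_trans:
  assumes "moves_toward G v0 D D'" "moves_toward G v0 D' D''"
  shows "moves_toward G v0 D D''"
proof -
  obtain y where y: "\<forall>u\<in>verts G. D u - D' u = edges_laplacian (edges G) y u" "y v0 = 0"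
      "\<forall>u\<in>verts G. y u \<ge> 0" "\<exists>u\<in>verts G. y u \<noteq> 0"
    using assms(1) unfolding moves_toward_def by blast
  obtain y' where y': "\<forall>u\<in>verts G. D' u - D'' u = edges_laplacian (edges G) y' u" "y' v0 = 0"
      "\<forall>u\<in>verts G. y' u \<ge> 0"
    using assms(2) unfolding moves_toward_def by blast
  have "\<forall>u\<in>verts G. D u - D'' u = edges_laplacian (edges G) (\<lambda>v. y v + y' v) u"
  proof
    fix u
    assume "u \<in> verts G"
    then show "D u - D'' u = edges_laplacian (edges G) (\<lambda>v. y v + y' v) u"
      unfolding edges_laplacian_add using bspec[OF y(1)] bspec[OF y'(1)] by fastforce
  qed
  moreover obtain u where "u \<in> verts G" "y u \<noteq> 0"
    using y(4) by blast
  then have "\<exists>u\<in>verts G. y u + y' u \<noteq> 0"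
    using bspec[OF y(3), of u] bspec[OF y'(3), of u] by (intro bexI[of _ u]) auto
  ultimately show ?thesis
    unfolding moves_toward_def using y(2,3) y'(2,3) by (intro exI[of _ "\<lambda>v. y v + y' v"]) simp
qed

text \<open>\<open>U\<close> is the set where \<open>y\<close> attains its maximum; the gap of 1
  outside it comes from integrality.\<close>

lemma argmax_obtain:
  fixes y :: "'a \<Rightarrow> int"
  assumes "verts G \<noteq> {}"
  obtains U where "U \<noteq> {}" "U \<subseteq> verts G"
    "\<And>u v. u \<in> U \<Longrightarrow> v \<in> verts G \<Longrightarrow> y v \<le> y u"
    "\<And>u v. u \<in> U \<Longrightarrow> v \<in> verts G \<Longrightarrow> v \<notin> U \<Longrightarrow> y v + 1 \<le> y u"
proof -
  let ?M = "Max (y ` verts G)"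
  have M: "y v \<le> ?M" if "v \<in> verts G" for v
    using that by simp
  have "?M \<in> y ` verts G"
    using assms by (intro Max_in) auto
  then have "{u \<in> verts G. y u = ?M} \<noteq> {}"
    by auto
  moreover have "y v + 1 \<le> y u" if "u \<in> {u \<in> verts G. y u = ?M}" "v \<in> verts G"
    "v \<notin> {u \<in> verts G. y u = ?M}" for u v
  proof -
    have "y v < ?M"
      using that M[of v] by (simp add: order_less_le)
    then show ?thesis
      using that by simp
  qed
  ultimately show thesis
    using that[of "{u \<in> verts G. y u = ?M}"] M by auto
qed

lemma positive_rankI:
  assumes "D \<in> divisors G"
    and "\<And>q. q \<in> verts G \<Longrightarrow> \<exists>F\<in>effective_divisors G. div_equiv G D F \<and> F q \<ge> 1"
  shows "positive_rank G D"
  unfolding positive_rank_def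
proof (intro ballI impI)
  fix E
  assume "E \<in> effective_divisors G" "div_degree G E = 1"
  then obtain q where q: "q \<in> verts G" "E = (\<lambda>v. if v = q then 1 else 0)"
    using effective_of_degree_1[OF finite_verts] by metis
  obtain F where F: "F \<in> effective_divisors G" "div_equiv G D F" "F q \<ge> 1"
    using assms(2)[OF q(1)] by blast
  have "(\<lambda>v. F v - E v) \<in> effective_divisors G"
    using F(1,3) q by (auto simp: effective_divisors_def divisors_def)
  moreover have "div_equiv G (\<lambda>v. D v - E v) (\<lambda>v. F v - E v)"
    using F(2) by (simp add: div_equiv_def)
  ultimately show "\<exists>F\<in>effective_divisors G. div_equiv G (\<lambda>v. D v - E v) F"
    by blast
qed

end

text \<open>Connectedness in cut form, matching its use: a firing set that misses \<open>v0\<close>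
  always sends out some chip.\<close>

locale connected_multigraph = finite_multigraph +
  fixes v0 :: 'a
  assumes root [simp]: "v0 \<in> verts G"
    and connected: "\<lbrakk>U \<subseteq> verts G; U \<noteq> {}; v0 \<notin> U\<rbrakk> \<Longrightarrow> \<exists>u\<in>U. out_degree (edges G) U u \<ge> 1"
begin

text \<open>If \<open>L y = 0\<close>, no edge leaves the maximum set of \<open>y\<close>. As
  \<open>y\<close> is nonnegative, not zero, and vanishes at \<open>v0\<close>, this set misses
  \<open>v0\<close>, contradicting connectedness.\<close>

lemma moves_toward_irrefl: "\<not> moves_toward G v0 D D"
proof
  assume "moves_toward G v0 D D"
  then obtain y where y: "\<And>u. u \<in> verts G \<Longrightarrow> edges_laplacian (edges G) y u = 0" "y v0 = 0"
      "\<And>u. u \<in> verts G \<Longrightarrow> y u \<ge> 0" "\<exists>u\<in>verts G. y u \<noteq> 0"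
    unfolding moves_toward_def by fastforce
  obtain U where U: "U \<noteq> {}" "U \<subseteq> verts G"
    "\<And>u v. u \<in> U \<Longrightarrow> v \<in> verts G \<Longrightarrow> y v \<le> y u"
    "\<And>u v. u \<in> U \<Longrightarrow> v \<in> verts G \<Longrightarrow> v \<notin> U \<Longrightarrow> y v + 1 \<le> y u"
    using argmax_obtain[of y] root by (metis empty_iff)
  have "v0 \<notin> U"
  proof
    assume "v0 \<in> U"
    then have "y v = 0" if "v \<in> verts G" for v
      using U(3)[of v0 v] y(2) y(3)[of v] that by simp
    then show False
      using y(4) by blast
  qed
  then obtain u where "u \<in> U" "out_degree (edges G) U u \<ge> 1"
    using connected[OF U(2,1)] by blast
  moreover have "out_degree (edges G) U u \<le> edges_laplacian (edges G) y u"
    using \<open>u \<in> U\<close> U by (intro out_degree_le_edges_laplacian) auto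
  ultimately show False
    using y(1)[of u] U(2) by auto
qed

text \<open>
  Moving chips towards \<open>v0\<close> must stop, because the class contains finitely many effective
  divisors; the divisor at which it stops is the \<open>v0\<close>-reduced one.
\<close>

lemma reduced_divisor_exists:
  assumes "D \<in> effective_divisors G"
  obtains R where "R \<in> effective_divisors G" "div_equiv G D R"
    "\<And>U. \<lbrakk>U \<subseteq> verts G; U \<noteq> {}; \<And>u. u \<in> U \<Longrightarrow> out_degree (edges G) U u \<le> R u\<rbrakk> \<Longrightarrow> v0 \<in> U"
proof -
  let ?X = "{F \<in> effective_divisors G. div_equiv G D F}"
  have "?X \<subseteq> {F \<in> effective_divisors G. div_degree G F = div_degree G D}"
    using assms div_degree_equiv effective_in_divisors by force
  then have "finite ?X"
    by (rule finite_subset) (rule finite_effective_divisors)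
  moreover have "D \<in> ?X"
    using assms div_equiv_refl[OF effective_in_divisors[OF assms]] by simp
  \<comment> \<open>A strict order on a finite set has a maximal element: here a divisor from which
    no further move towards \<open>v0\<close> stays effective.\<close>
  ultimately have "\<exists>R\<in>?X. \<forall>F\<in>?X. F \<noteq> R \<longrightarrow> \<not> moves_toward G v0 R F"
  proof (intro Finite_Set.bex_max_element)
    show "asymp_on ?X (moves_toward G v0)"
      using moves_toward_trans moves_toward_irrefl by (intro asymp_onI) blast
    show "transp_on ?X (moves_toward G v0)"
      using moves_toward_trans by (intro transp_onI) blast
  qed auto
  then obtain R where R: "R \<in> effective_divisors G" "div_equiv G D R"
    "\<And>F. F \<in> effective_divisors G \<Longrightarrow> div_equiv G D F \<Longrightarrow> \<not> moves_toward G v0 R F"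
    using moves_toward_irrefl by auto
  show thesis
  proof (rule that[OF R(1,2)], rule ccontr)
    fix U
    assume U: "U \<subseteq> verts G" "U \<noteq> {}" "\<And>u. u \<in> U \<Longrightarrow> out_degree (edges G) U u \<le> R u" "v0 \<notin> U"
    let ?y = "\<lambda>v. if v \<in> U then 1 else 0 :: int"
    \<comment> \<open>A legal set that misses \<open>v0\<close> could be fired once more, against
      maximality. The guard makes \<open>F\<close> vanish outside the graph.\<close>
    define F where "F = (\<lambda>u. if u \<in> verts G then R u - edges_laplacian (edges G) ?y u else 0)"
    have "F u \<ge> 0" for u
    proof -
      have "edges_laplacian (edges G) ?y u \<le> out_degree (edges G) U u"
        by (rule edges_laplacian_indicator)
      also have "\<dots> \<le> R u"
        using U(3) R(1) out_degree_eq_0[of u U]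
        by (cases "u \<in> U") (auto simp: effective_divisors_def)
      finally show ?thesis
        by (simp add: F_def)
    qed
    then have F: "F \<in> effective_divisors G"
      by (auto simp: effective_divisors_def divisors_def F_def)
    have "div_equiv G R F"
      using F R(1) by (subst div_equiv_iff) (auto simp: F_def effective_in_divisors)
    then have "div_equiv G D F"
      using div_equiv_trans[of D R F] R(1,2) F assms effective_in_divisors by blast
    moreover have "moves_toward G v0 R F"
      unfolding moves_toward_def using U by (intro exI[of _ ?y]) (auto simp: F_def)
    ultimately show False
      using R(3) F by blast
  qed
qed

lemma positive_rank_obtain:
  assumes "positive_rank G D" "D \<in> divisors G" "q \<in> verts G"
  obtains F where "F \<in> effective_divisors G" "div_equiv G D F" "F q \<ge> 1"
proof -
  let ?E = "\<lambda>v. if v = q then 1 else 0 :: int"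
  obtain F where F: "F \<in> effective_divisors G" "div_equiv G (\<lambda>v. D v - ?E v) F"
    using assms point_divisor[OF finite_verts assms(3), of 1] unfolding positive_rank_def by auto
  have "(\<lambda>v. D v - ?E v) \<in> divisors G" "(\<lambda>v. F v + ?E v) \<in> effective_divisors G"
    using F(1) assms by (auto simp: effective_divisors_def divisors_def)
  moreover have "(\<lambda>v. D v - (F v + ?E v)) = (\<lambda>v. D v - ?E v - F v)"
    by auto
  then have "div_equiv G D (\<lambda>v. F v + ?E v)"
    using F(2) by (simp only: div_equiv_def)
  moreover have "F q + ?E q \<ge> 1"
    using F by (auto simp: effective_divisors_def)
  ultimately show thesis
    using that by blast
qed

text \<open>\<open>R\<close> is the reduced divisor. For an equivalent \<open>F\<close> with a chip
  on \<open>q\<close>, the maximum set of the function leading from \<open>R\<close> to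
  \<open>F\<close> serves as \<open>U\<close>: it is legal, so it contains \<open>v0\<close> by
  reducedness.\<close>

lemma positive_rank_legal_sets:
  assumes "positive_rank G D" "D \<in> divisors G"
  obtains R where "R \<in> effective_divisors G" "div_degree G R = div_degree G D"
    "\<forall>q\<in>verts G. R q = 0 \<longrightarrow> (\<exists>U. U \<subseteq> verts G \<and> v0 \<in> U \<and> q \<notin> U \<and>
      (\<forall>u\<in>verts G. out_degree (edges G) U u \<le> R u))"
proof -
  obtain F0 where F0: "F0 \<in> effective_divisors G" "div_equiv G D F0"
    using positive_rank_obtain assms root by blast
  obtain R where R: "R \<in> effective_divisors G" "div_equiv G F0 R"
    "\<And>U. \<lbrakk>U \<subseteq> verts G; U \<noteq> {}; \<And>u. u \<in> U \<Longrightarrow> out_degree (edges G) U u \<le> R u\<rbrakk> \<Longrightarrow> v0 \<in> U"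
    using reduced_divisor_exists F0 by metis
  have DR: "div_equiv G D R"
    using div_equiv_trans[of D F0 R] F0 R(1,2) assms effective_in_divisors by blast
  have "\<exists>U. U \<subseteq> verts G \<and> v0 \<in> U \<and> q \<notin> U \<and>
      (\<forall>u\<in>verts G. out_degree (edges G) U u \<le> R u)" if q: "q \<in> verts G" "R q = 0" for q
  proof -
    obtain F where F: "F \<in> effective_divisors G" "div_equiv G D F" "F q \<ge> 1"
      using positive_rank_obtain assms q by blast
    have "div_equiv G R F"
      using div_equiv_trans[of R D F] div_equiv_sym[of D R] DR F(1,2) R(1) assms(2) effective_in_divisors
      by blast
    then obtain y where y: "\<And>u. u\<in>verts G \<Longrightarrow> R u - F u = edges_laplacian (edges G) y u"
      using div_equiv_iff[of R F] F(1) R(1) effective_in_divisors by blast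
    obtain U where U: "U \<noteq> {}" "U \<subseteq> verts G"
      "\<And>u v. u \<in> U \<Longrightarrow> v \<in> verts G \<Longrightarrow> y v \<le> y u"
      "\<And>u v. u \<in> U \<Longrightarrow> v \<in> verts G \<Longrightarrow> v \<notin> U \<Longrightarrow> y v + 1 \<le> y u"
      using argmax_obtain[of y] root by (metis empty_iff)
    have legal: "out_degree (edges G) U u \<le> R u - F u" if "u \<in> U" for u
    proof -
      have "out_degree (edges G) U u \<le> edges_laplacian (edges G) y u"
        using that U by (intro out_degree_le_edges_laplacian) auto
      then show ?thesis
        using y that U(2) by (metis subsetD)
    qed
    have nonneg: "F u \<ge> 0" "R u \<ge> 0" for u
      using F(1) R(1) by (auto simp: effective_divisors_def)
    have le: "out_degree (edges G) U u \<le> R u" for u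
      using legal[of u] nonneg[of u] out_degree_eq_0[of u U] by (cases "u \<in> U") auto
    then have "v0 \<in> U"
      using R(3)[OF U(2,1)] by blast
    \<comment> \<open>In \<open>U\<close>, the vertex \<open>q\<close> would have an out-degree of
      at most \<open>R q - F q\<close>, which is negative.\<close>
    moreover have "q \<notin> U"
      using legal[of q] q F(3) out_degree_nonneg[of "edges G" U q] by auto
    ultimately show ?thesis
      using U(2) le by blast
  qed
  moreover have "div_degree G R = div_degree G D"
    using div_degree_equiv[OF _ _ DR] R(1) assms(2) effective_in_divisors by metis
  ultimately show thesis
    using that R(1) by blast
qed

end

section \<open>Paths and cycles\<close>

lemma path_edges_append:
  "path_edges (xs @ a # ys) = path_edges (xs @ [a]) + path_edges (a # ys)"
proof (induction xs)
  case (Cons x xs)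
  then show ?case
    by (cases xs) auto
qed simp

lemma path_edges_Cons: "vs \<noteq> [] \<Longrightarrow> path_edges (v # vs) = add_mset {v, hd vs} (path_edges vs)"
  by (cases vs) auto

lemma path_edges_subset: "e \<in># path_edges vs \<Longrightarrow> e \<subseteq> set vs"
  by (induction vs rule: path_edges.induct) auto

lemma path_edges_card: "\<lbrakk>distinct vs; e \<in># path_edges vs\<rbrakk> \<Longrightarrow> card e = 2"
  by (induction vs rule: path_edges.induct) auto

lemma path_edges_laplacian_const:
  assumes "\<And>v. v \<in> set vs \<Longrightarrow> y v = c"
  shows "edges_laplacian (path_edges vs) y u = 0"
  using assms path_edges_subset by (intro edges_laplacian_const) blast

text \<open>The first change of membership in \<open>U\<close> along the list is an edge leaving
  \<open>U\<close>, in whichever direction it is crossed; the vertex found is its end inside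
  \<open>U\<close>.\<close>

lemma path_out_degree_pos:
  assumes "x \<in> set vs" "x \<in> U" "w \<in> set vs" "w \<notin> U"
  shows "\<exists>u\<in>set vs \<inter> U. out_degree (path_edges vs) U u \<ge> 1"
  using assms
proof (induction vs arbitrary: x w rule: path_edges.induct)
  case (1 a b vs)
  have split: "out_degree (path_edges (a # b # vs)) U u
      = (if u \<in> {a, b} \<inter> U then int (card ({a, b} - U)) else 0)
        + out_degree (path_edges (b # vs)) U u" for u
    by (simp add: out_degree_def)
  show ?case
  proof (cases "a \<in> U \<longleftrightarrow> b \<in> U")
    case True
    then obtain x' w' where "x' \<in> set (b # vs)" "x' \<in> U" "w' \<in> set (b # vs)" "w' \<notin> U"
      using "1.prems" by (metis list.set_intros(1) set_ConsD)
    then obtain u where "u \<in> set (b # vs) \<inter> U" "out_degree (path_edges (b # vs)) U u \<ge> 1"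
      using "1.IH"[of x' w'] by blast
    then show ?thesis
      using split[of u] by (intro bexI[of _ u]) auto
  next
    case False
    then obtain u where u: "u \<in> {a, b} \<inter> U" "card ({a, b} - U) = 1"
      using that[of a] that[of b] by (cases "a \<in> U") (simp_all add: insert_Diff_if)
    then have "out_degree (path_edges (a # b # vs)) U u \<ge> 1"
      using split[of u] out_degree_nonneg[of "path_edges (b # vs)" U u] by simp
    then show ?thesis
      using u(1) by auto
  qed
qed auto

lemma sum_path_out_degree_ge:
  assumes "x \<in> set vs" "x \<in> U" "w \<in> set vs" "w \<notin> U"
    and "finite S" "set vs \<inter> U \<subseteq> S"
  shows "(\<Sum>u\<in>S. out_degree (path_edges vs) U u) \<ge> 1"
proof -
  obtain u where u: "u \<in> set vs \<inter> U" "out_degree (path_edges vs) U u \<ge> 1"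
    using path_out_degree_pos[OF assms(1-4)] by blast
  then have "out_degree (path_edges vs) U u \<le> (\<Sum>u\<in>S. out_degree (path_edges vs) U u)"
    using assms(5,6) by (intro member_le_sum) (auto simp: out_degree_nonneg)
  then show ?thesis
    using u by linarith
qed

lemma path_edges_append_nonempty:
  assumes "vs \<noteq> []" "ws \<noteq> []"
  shows "path_edges (vs @ ws) = path_edges vs + {#{last vs, hd ws}#} + path_edges ws"
proof -
  have "path_edges (vs @ ws) = path_edges (butlast vs @ last vs # ws)"
    using assms(1) by (metis append_butlast_last_id append.assoc append_Cons append_Nil)
  also have "\<dots> = path_edges (butlast vs @ [last vs]) + path_edges (last vs # ws)"
    by (rule path_edges_append)
  finally show ?thesis
    using assms by (simp add: path_edges_Cons)
qed

text \<open>Only the edge joining the two blocks has ends of different value; it carries one chip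
  from \<open>hd ws\<close> to \<open>last vs\<close>.\<close>

lemma path_edges_laplacian_step:
  assumes "vs \<noteq> []" "ws \<noteq> []" "\<And>v. v \<in> set vs \<Longrightarrow> y v = 0" "\<And>v. v \<in> set ws \<Longrightarrow> y v = 1"
  shows "edges_laplacian (path_edges (vs @ ws)) y u
    = (if u = hd ws then 1 else 0) - (if u = last vs then 1 else 0)"
proof -
  have "edges_laplacian (path_edges vs) y u = 0" "edges_laplacian (path_edges ws) y u = 0"
    using assms(3,4) by (auto intro: path_edges_laplacian_const)
  moreover have "y (last vs) = 0" "y (hd ws) = 1"
    using assms by simp_all
  ultimately show ?thesis
    unfolding path_edges_append_nonempty[OF assms(1,2)] by auto
qed

text \<open>Two vertices cut a cycle into two arcs. Unlike the closed list of the cycle, each arc is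
  a list without repetitions.\<close>

lemma cycle_edges_split:
  assumes "distinct C" "a \<in> set C" "b \<in> set C" "a \<noteq> b"
  obtains xs ys where "cycle_edges C = path_edges (a # xs @ [b]) + path_edges (b # ys @ [a])"
    "set C = insert a (insert b (set xs \<union> set ys))" "distinct (a # b # xs @ ys)"
proof -
  \<comment> \<open>The case where \<open>a\<close> comes first in the list; the other one follows
    by exchanging \<open>a\<close> and \<open>b\<close>, which also exchanges the arcs.\<close>
  have *: "\<exists>xs ys. cycle_edges C = path_edges (a # xs @ [b]) + path_edges (b # ys @ [a]) \<and>
      set C = insert a (insert b (set xs \<union> set ys)) \<and> distinct (a # b # xs @ ys)"
    if "C = ps @ a # qs @ b # rs" "distinct C" for a b ps qs rs
  \<comment> \<open>The second arc runs to the end of the list and continues at its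
    beginning.\<close>
  proof (rule exI[of _ qs], rule exI[of _ "rs @ ps"], intro conjI)
    show "cycle_edges C = path_edges (a # qs @ [b]) + path_edges (b # (rs @ ps) @ [a])"
    \<comment> \<open>If \<open>ps\<close> is empty, the list closes at \<open>a\<close> itself.
      Otherwise it closes at \<open>p\<close>, where the two parts of the second arc are glued
      together.\<close>
    proof (cases ps)
      case Nil
      then have "cycle_edges C = path_edges ((a # qs) @ b # rs @ [a])"
        using that by (simp add: cycle_edges_def)
      then show ?thesis
        by (subst (asm) path_edges_append) (simp add: Nil)
    next
      case (Cons p ps')
      then have "cycle_edges C = path_edges (ps @ a # qs @ b # rs @ [p])"
        using that by (simp add: cycle_edges_def)
      also have "\<dots> = path_edges (ps @ [a]) + path_edges ((a # qs) @ b # rs @ [p])"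
        by (subst path_edges_append) simp
      also have "\<dots> = path_edges (ps @ [a]) + (path_edges (a # qs @ [b]) + path_edges (b # rs @ [p]))"
        by (subst path_edges_append) simp
      also have "\<dots> = path_edges (a # qs @ [b]) + (path_edges ((b # rs) @ [p]) + path_edges (p # ps' @ [a]))"
        using Cons by simp
      also have "path_edges ((b # rs) @ [p]) + path_edges (p # ps' @ [a])
          = path_edges ((b # rs) @ p # ps' @ [a])"
        by (rule path_edges_append[symmetric])
      finally show ?thesis
        using Cons by simp
    qed
  qed (use that in auto)
  obtain ps qs where C: "C = ps @ a # qs"
    using assms(2) split_list by fast
  consider "b \<in> set ps" | "b \<in> set qs"
    using assms C by auto
  then show thesis
  proof cases
    case 1
    then obtain ps1 ps2 where "ps = ps1 @ b # ps2"
      using split_list by fast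
    then have "C = ps1 @ b # ps2 @ a # qs"
      using C by simp
    from *[OF this assms(1)] obtain xs ys where
      "cycle_edges C = path_edges (b # xs @ [a]) + path_edges (a # ys @ [b])"
      "set C = insert b (insert a (set xs \<union> set ys))" "distinct (b # a # xs @ ys)"
      by blast
    then show thesis
      by (intro that[of ys xs]) auto
  next
    case 2
    then obtain qs1 qs2 where "qs = qs1 @ b # qs2"
      using split_list by fast
    then have "C = ps @ a # qs1 @ b # qs2"
      using C by simp
    from *[OF this assms(1)] show thesis
      using that by blast
  qed
qed

section \<open>Moving chips along a path\<close>

context finite_multigraph
begin

lemma effective_by_firing:
  assumes "D \<in> effective_divisors G"
    and "\<And>u. u \<in> verts G \<Longrightarrow> D' u = D u - edges_laplacian (edges G) y u"
    and "\<And>u. u \<in> verts G \<Longrightarrow> D' u \<ge> 0" "\<And>u. u \<notin> verts G \<Longrightarrow> D' u = 0"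
  shows "D' \<in> effective_divisors G" "div_equiv G D D'"
proof -
  show D': "D' \<in> effective_divisors G"
    using assms(3,4) by (force simp: effective_divisors_def divisors_def)
  show "div_equiv G D D'"
    using assms(2) div_equiv_iff[of D D'] assms(1) D' effective_in_divisors by auto
qed

text \<open>
  Two chips at the ends of a path whose inner vertices have no further neighbours can be moved
  towards each other, one step at a time.
\<close>

lemma path_ends_cover:
  assumes "edges G = R + path_edges (a # xs @ [b])" "distinct xs" "a \<notin> set xs" "b \<notin> set xs"
    and "\<And>e. e \<in># R \<Longrightarrow> e \<inter> set xs = {}"
    and "D \<in> effective_divisors G" "D a \<ge> 1" "D b \<ge> 1" "a \<noteq> b" "q \<in> set xs"
    and "insert a (insert b (set xs)) \<subseteq> verts G"
  shows "\<exists>D'\<in>effective_divisors G. div_equiv G D D' \<and> D' q \<ge> 1"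
  using assms
proof (induction "length xs" arbitrary: R a b xs D rule: less_induct)
  case less
  obtain c ys where xs: "xs = c # ys"
    using less.prems(10) by (cases xs) auto
  obtain zs d where xs': "xs = zs @ [d]"
    using less.prems(10) by (cases xs rule: rev_cases) auto
  \<comment> \<open>The value -1 on the inner vertices amounts to firing everything else:
    \<open>a\<close> and \<open>b\<close> each send one chip inwards.\<close>
  let ?y = "\<lambda>v. if v \<in> set xs then -1 else 0 :: int"
  let ?pt = "\<lambda>x v. if v = x then 1 else 0 :: int"
  \<comment> \<open>If the path has a single inner vertex, then \<open>c = d\<close> and it receives
    both chips.\<close>
  define D1 where "D1 = (\<lambda>v. D v - ?pt a v - ?pt b v + ?pt c v + ?pt d v)"
  have split: "path_edges (a # xs @ [b]) = {#{a, c}#} + (path_edges xs + {#{d, b}#})"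
  proof -
    have "path_edges (a # xs @ [b]) = add_mset {a, c} (path_edges (xs @ [b]))"
      using xs by simp
    then show ?thesis
      using xs' path_edges_append[of zs d "[b]"] by simp
  qed
  have cd: "c \<in> set xs" "d \<in> set xs"
    using xs xs' by (metis in_set_conv_decomp list.set_intros(1))+
  \<comment> \<open>\<open>?y\<close> is constant on every edge other than the two end edges of the
    path.\<close>
  have "edges_laplacian R ?y u = 0" for u
    using less.prems(5) by (intro edges_laplacian_const[of _ _ 0]) auto
  moreover have "edges_laplacian (path_edges xs) ?y u = 0" for u
    by (rule path_edges_laplacian_const[of _ _ "-1"]) auto
  ultimately have lap: "edges_laplacian (edges G) ?y u
      = ?pt a u + ?pt b u - ?pt c u - ?pt d u" for u
    using less.prems(3,4) cd unfolding less.prems(1) split by auto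
  have D: "D u \<ge> 0" "u \<notin> verts G \<Longrightarrow> D u = 0" for u
    using less.prems(6) by (auto simp: effective_divisors_def divisors_def)
  have D1: "D1 \<in> effective_divisors G" "div_equiv G D D1"
  proof -
    have nonneg: "D1 u \<ge> 0" for u
      using less.prems(7-9) D(1)[of u] unfolding D1_def by auto
    have zero: "D1 u = 0" if "u \<notin> verts G" for u
      using less.prems(11) cd D(2)[of u] that unfolding D1_def by auto
    have firing: "D1 u = D u - edges_laplacian (edges G) ?y u" for u
      unfolding lap by (simp add: D1_def)
    show "D1 \<in> effective_divisors G"
      by (rule effective_by_firing(1)[OF less.prems(6) firing nonneg zero])
    show "div_equiv G D D1"
      by (rule effective_by_firing(2)[OF less.prems(6) firing nonneg zero])
  qed
  show ?case
  proof (cases "q = c \<or> q = d")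
    case True
    have "D1 q \<ge> 1"
      using True cd less.prems(3,4) D(1)[of q] by (auto simp: D1_def)
    then show ?thesis
      using D1 by blast
  next
    case False
    \<comment> \<open>As \<open>q\<close> is neither \<open>c\<close> nor \<open>d\<close>, it lies
      strictly between them, so these are distinct and bound a shorter path.\<close>
    then obtain ws where ws: "xs = c # ws @ [d]" "q \<in> set ws"
      using xs xs' less.prems(10) by (cases ys rule: rev_cases) auto
    have "\<exists>D'\<in>effective_divisors G. div_equiv G D1 D' \<and> D' q \<ge> 1"
    \<comment> \<open>The two end edges just crossed now count as part of the rest of the
      graph.\<close>
    proof (rule less.hyps[of ws "add_mset {a, c} (add_mset {d, b} R)" c d])
      show "edges G = add_mset {a, c} (add_mset {d, b} R) + path_edges (c # ws @ [d])"
        using less.prems(1) split ws(1) by simp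
      show "D1 c \<ge> 1" "D1 d \<ge> 1" "c \<noteq> d"
        using less.prems(2-4) ws D(1)[of c] D(1)[of d] by (auto simp: D1_def)
      show "e \<inter> set ws = {}" if "e \<in># add_mset {a, c} (add_mset {d, b} R)" for e
        using that less.prems(2-5) ws(1) by auto
    qed (use ws D1 less.prems in auto)
    then show ?thesis
      using div_equiv_trans[OF _ _ _ D1(2)] D1(1) less.prems(6) effective_in_divisors by blast
  qed
qed

end

section \<open>Tricycle graphs\<close>

text \<open>\<open>GREATEST\<close> is determined only if the maximum is attained; here it is 0 or
  -1, depending on whether \<open>P 0\<close> holds.\<close>

lemma int_Greatest_le:
  fixes P :: "int \<Rightarrow> bool"
  assumes "P (-1)" "\<And>k. P k \<Longrightarrow> k \<le> 0"
  shows "(GREATEST k. P k) \<le> 0"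
proof (cases "P 0")
  case True
  then show ?thesis
    using assms(2) by (simp add: Greatest_equality)
next
  case False
  have "k \<le> -1" if "P k" for k
    using assms(2)[OF that] False that by (cases "k = 0") auto
  then have "(GREATEST k. P k) = -1"
    using assms(1) by (intro Greatest_equality)
  then show ?thesis
    by simp
qed

lemma less_3_cases: "(i::nat) < 3 \<longleftrightarrow> i = 0 \<or> i = 1 \<or> i = 2"
  by auto

lemma sum_less_3_rotate:
  fixes f :: "nat \<Rightarrow> 'b::comm_monoid_add"
  assumes "i < 3"
  shows "sum f {..<3} = f i + (f ((i + 1) mod 3) + f ((i + 2) mod 3))"
proof -
  have "{..<3::nat} = {i, (i + 1) mod 3, (i + 2) mod 3}"
    using assms unfolding less_3_cases by auto
  moreover have "i \<noteq> (i + 1) mod 3" "i \<noteq> (i + 2) mod 3" "(i + 1) mod 3 \<noteq> (i + 2) mod 3"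
    using assms unfolding less_3_cases by auto
  ultimately show ?thesis
    by simp
qed

lemma distinct_concat_3:
  assumes "distinct (v # concat (map f [0..<3]))" "i < 3"
  shows "distinct (v # f i)" "\<lbrakk>j < 3; i \<noteq> j\<rbrakk> \<Longrightarrow> set (f i) \<inter> set (f j) = {}"
proof -
  have "[0..<3] = [0, 1, 2::nat]"
    by (simp add: upt_rec numeral_eq_Suc)
  then have *: "distinct (v # f 0 @ f 1 @ f 2)"
    using assms by simp
  show "distinct (v # f i)" "\<lbrakk>j < 3; i \<noteq> j\<rbrakk> \<Longrightarrow> set (f i) \<inter> set (f j) = {}"
    using * assms(2) unfolding less_3_cases by auto
qed

text \<open>Here \<open>a\<close>, \<open>b\<close>, \<open>c\<close>, \<open>d\<close> say whether
  the hubs of the other two cycles, in cyclic order, belong to a set containing \<open>v0\<close>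
  but neither hub of the remaining cycle. The left side bounds the cut from below. The last 1 stands
  for the spoke or the link at the hub of \<open>d\<close>, exactly one of which is cut.\<close>

lemma wheel_cut:
  assumes "2 + (if a then 1 else 0)
      + ((if a \<longleftrightarrow> b then 0 else 2) + (if a then 0 else 1) + (if b then 0 else 1)
         + (if b \<longleftrightarrow> c then 0 else 1))
      + ((if c \<longleftrightarrow> d then 0 else 2) + (if c then 0 else 1) + 1) \<le> (5 :: int)"
  shows a d
  using assms by (cases a; cases b; cases c; cases d; simp)+

section \<open>The tricycle graph as a connected multigraph\<close>

locale tricycle =
  fixes G :: "'a multigraph" and v0 :: 'a and C :: "nat \<Rightarrow> 'a list" and vm vp :: "nat \<Rightarrow> 'a"
    and Pm Pp :: "nat \<Rightarrow> 'a list"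
  assumes hubs: "i < 3 \<Longrightarrow> vm i \<in> set (C i)" "i < 3 \<Longrightarrow> vp i \<in> set (C i)"
    "i < 3 \<Longrightarrow> vm i \<noteq> vp i"
    and distinct_verts: "distinct (v0 # concat (map (\<lambda>i. C i @ Pm i @ Pp i) [0..<3]))"
    and verts_eq: "verts G = insert v0 (\<Union>i<3. set (C i) \<union> set (Pm i) \<union> set (Pp i))"
    and edges_eq: "edges G =
          (\<Sum>i<3. cycle_edges (C i) + {#{vp i, vm ((i + 1) mod 3)}#}
                 + path_edges (v0 # Pm i @ [vm i]) + path_edges (v0 # Pp i @ [vp i]))"
begin

abbreviation region_edges :: "nat \<Rightarrow> 'a set multiset" where
  "region_edges i \<equiv> cycle_edges (C i) + {#{vp i, vm ((i + 1) mod 3)}#}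
     + path_edges (v0 # Pm i @ [vm i]) + path_edges (v0 # Pp i @ [vp i])"

lemma region_distinct: "i < 3 \<Longrightarrow> distinct (v0 # C i @ Pm i @ Pp i)"
  by (rule distinct_concat_3(1)[OF distinct_verts])

lemma region_disjoint:
  "\<lbrakk>i < 3; j < 3; i \<noteq> j\<rbrakk> \<Longrightarrow> set (C i @ Pm i @ Pp i) \<inter> set (C j @ Pm j @ Pp j) = {}"
  by (rule distinct_concat_3(2)[OF distinct_verts])

lemma hubs_in_verts: "i < 3 \<Longrightarrow> vm i \<in> verts G" "i < 3 \<Longrightarrow> vp i \<in> verts G"
  using hubs unfolding verts_eq by blast+

lemma hub_neq: "\<lbrakk>i < 3; j < 3; i \<noteq> j\<rbrakk> \<Longrightarrow> vp i \<noteq> vm j"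
  using region_disjoint[of i j] hubs(1)[of j] hubs(2)[of i] by auto

lemma distinct_spokes:
  assumes "i < 3"
  shows "distinct (v0 # Pm i @ [vm i])" "distinct (v0 # Pp i @ [vp i])"
  using region_distinct[OF assms] hubs[OF assms] by auto

lemma region_arcs:
  assumes "i < 3"
  obtains xs ys where
    "cycle_edges (C i) = path_edges (vm i # xs @ [vp i]) + path_edges (vp i # ys @ [vm i])"
    "set (C i) = insert (vm i) (insert (vp i) (set xs \<union> set ys))"
    "distinct (vm i # vp i # xs @ ys)"
  using cycle_edges_split[of "C i" "vm i" "vp i" thesis] region_distinct[OF assms] hubs[OF assms]
  by auto

text \<open>\<open>path_edges_card\<close> asks for distinct vertices, while the closed list of a
  cycle repeats its head, so the cycle is first cut into arcs.\<close>

lemma region_edges_verts: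
  assumes "i < 3" "e \<in># region_edges i"
  shows "card e = 2" "e \<subseteq> verts G"
proof -
  let ?j = "(i + 1) mod 3"
  have j: "?j < 3" "i \<noteq> ?j"
    using assms(1) unfolding less_3_cases by auto
  obtain xs ys where arcs:
    "cycle_edges (C i) = path_edges (vm i # xs @ [vp i]) + path_edges (vp i # ys @ [vm i])"
    "set (C i) = insert (vm i) (insert (vp i) (set xs \<union> set ys))"
    "distinct (vm i # vp i # xs @ ys)"
    using region_arcs[OF assms(1)] .
  have in_verts: "set (C i) \<union> set (Pm i) \<union> set (Pp i) \<subseteq> verts G" "v0 \<in> verts G"
    using assms(1) verts_eq by auto
  consider "e \<in># path_edges (vm i # xs @ [vp i])" | "e \<in># path_edges (vp i # ys @ [vm i])"
    | "e = {vp i, vm ?j}" | "e \<in># path_edges (v0 # Pm i @ [vm i])"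
    | "e \<in># path_edges (v0 # Pp i @ [vp i])"
    using assms(2) arcs(1) by auto
  then have "card e = 2 \<and> e \<subseteq> verts G"
  proof cases
    case 1
    have "distinct (vm i # xs @ [vp i])" "set (vm i # xs @ [vp i]) \<subseteq> verts G"
      using arcs(2,3) in_verts(1) by auto
    then show ?thesis
      using path_edges_card[OF _ 1] path_edges_subset[OF 1] by blast
  next
    case 2
    have "distinct (vp i # ys @ [vm i])" "set (vp i # ys @ [vm i]) \<subseteq> verts G"
      using arcs(2,3) in_verts(1) by auto
    then show ?thesis
      using path_edges_card[OF _ 2] path_edges_subset[OF 2] by blast
  next
    case 3
    then show ?thesis
      using hub_neq[OF assms(1) j] hubs_in_verts(1)[OF j(1)] hubs_in_verts(2)[OF assms(1)] by simp
  next
    case 4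
    then show ?thesis
      using path_edges_card[OF distinct_spokes(1)[OF assms(1)] 4] path_edges_subset[OF 4] in_verts
        hubs_in_verts[OF assms(1)] by auto
  next
    case 5
    then show ?thesis
      using path_edges_card[OF distinct_spokes(2)[OF assms(1)] 5] path_edges_subset[OF 5] in_verts
        hubs_in_verts[OF assms(1)] by auto
  qed
  then show "card e = 2" "e \<subseteq> verts G"
    by auto
qed

lemma region_edges_subset:
  assumes "i < 3"
  shows "region_edges i \<subseteq># edges G"
proof -
  have "edges G = region_edges i + sum region_edges ({..<3} - {i})"
    unfolding edges_eq by (rule sum.remove) (use assms in auto)
  then show ?thesis
    by simp
qed

sublocale finite_multigraph G
proof
  show "finite (verts G)"
    by (simp add: verts_eq)
  fix e
  assume "e \<in># edges G"
  then obtain i where "i < 3" "e \<in># region_edges i"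
    unfolding edges_eq set_mset_sum[OF finite_lessThan] by blast
  then show "card e = 2" "e \<subseteq> verts G"
    by (rule region_edges_verts)+
qed

lemma piece_connected:
  assumes "path_edges vs \<subseteq># edges G" "x \<in> set vs" "x \<in> U" "w \<in> set vs" "w \<notin> U"
  shows "\<exists>u\<in>U. out_degree (edges G) U u \<ge> 1"
proof -
  obtain u where "u \<in> U" "out_degree (path_edges vs) U u \<ge> 1"
    using path_out_degree_pos[OF assms(2-5)] by blast
  then show ?thesis
    using order_trans[OF _ out_degree_mono[OF assms(1), of U u]] by blast
qed

sublocale connected_multigraph G v0
proof
  show "v0 \<in> verts G"
    by (simp add: verts_eq)
  fix U
  assume U: "U \<subseteq> verts G" "U \<noteq> {}" "v0 \<notin> U"
  then obtain x i where x: "x \<in> U" "i < 3" "x \<in> set (C i) \<union> set (Pm i) \<union> set (Pp i)"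
    unfolding verts_eq by blast
  obtain xs ys where arcs:
    "cycle_edges (C i) = path_edges (vm i # xs @ [vp i]) + path_edges (vp i # ys @ [vm i])"
    "set (C i) = insert (vm i) (insert (vp i) (set xs \<union> set ys))"
    using region_arcs[OF x(2)] by metis
  have sub: "path_edges (vm i # xs @ [vp i]) \<subseteq># edges G" "path_edges (vp i # ys @ [vm i]) \<subseteq># edges G"
      "path_edges (v0 # Pm i @ [vm i]) \<subseteq># edges G" "path_edges (v0 # Pp i @ [vp i]) \<subseteq># edges G"
    by (rule subset_mset.order_trans[OF _ region_edges_subset[OF x(2)]],
        simp add: arcs(1) subseteq_mset_def)+
  show "\<exists>u\<in>U. out_degree (edges G) U u \<ge> 1"
  \<comment> \<open>If \<open>U\<close> meets a spoke or its hub, that path joins \<open>U\<close>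
    to \<open>v0\<close>, which is outside. Otherwise \<open>U\<close> meets an arc of the cycle
    whose ends, the hubs, are both outside.\<close>
  proof (cases "(\<exists>v\<in>set (Pm i @ [vm i]). v \<in> U) \<or> (\<exists>v\<in>set (Pp i @ [vp i]). v \<in> U)")
    case True
    then show ?thesis
      using piece_connected[OF sub(3) _ _ _ U(3)] piece_connected[OF sub(4) _ _ _ U(3)] by auto
  next
    case False
    then have "x \<in> set xs \<or> x \<in> set ys" "vm i \<notin> U"
      using x arcs(2) by auto
    then show ?thesis
      using piece_connected[OF sub(1) _ x(1), of "vm i"] piece_connected[OF sub(2) _ x(1), of "vm i"]
      by auto
  qed
qed

subsection \<open>The lower bound\<close>

text \<open>Separating the hubs cuts both arcs, and cutting a hub off from \<open>v0\<close> cuts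
  its spoke. Out-degrees count only at vertices of \<open>U\<close>, so on a spoke \<open>S\<close>
  may omit the hub, which lies outside \<open>U\<close>.\<close>

lemma region_sum_out_degree_ge:
  assumes "i < 3" "finite S"
  shows "\<lbrakk>(vm i \<in> U) \<noteq> (vp i \<in> U); set (C i) \<subseteq> S\<rbrakk> \<Longrightarrow>
      (\<Sum>u\<in>S. out_degree (cycle_edges (C i)) U u) \<ge> 2"
    and "\<lbrakk>v0 \<in> U; vm i \<notin> U; insert v0 (set (Pm i)) \<subseteq> S\<rbrakk> \<Longrightarrow>
      (\<Sum>u\<in>S. out_degree (path_edges (v0 # Pm i @ [vm i])) U u) \<ge> 1"
    and "\<lbrakk>v0 \<in> U; vp i \<notin> U; insert v0 (set (Pp i)) \<subseteq> S\<rbrakk> \<Longrightarrow>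
      (\<Sum>u\<in>S. out_degree (path_edges (v0 # Pp i @ [vp i])) U u) \<ge> 1"
proof -
  obtain xs ys where arcs:
    "cycle_edges (C i) = path_edges (vm i # xs @ [vp i]) + path_edges (vp i # ys @ [vm i])"
    "set (C i) = insert (vm i) (insert (vp i) (set xs \<union> set ys))"
    using region_arcs[OF assms(1)] by metis
  show "(\<Sum>u\<in>S. out_degree (cycle_edges (C i)) U u) \<ge> 2"
    if sep: "(vm i \<in> U) \<noteq> (vp i \<in> U)" and S: "set (C i) \<subseteq> S"
  proof -
    obtain x w where xw: "{x, w} = {vm i, vp i}" "x \<in> U" "w \<notin> U"
      using sep by (cases "vm i \<in> U") auto
    have "(\<Sum>u\<in>S. out_degree (path_edges (vm i # xs @ [vp i])) U u) \<ge> 1"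
      "(\<Sum>u\<in>S. out_degree (path_edges (vp i # ys @ [vm i])) U u) \<ge> 1"
      by (rule sum_path_out_degree_ge[of x _ U w]; use xw assms(2) S arcs(2) in auto)+
    then show ?thesis
      by (simp add: arcs(1) sum.distrib)
  qed
  show "(\<Sum>u\<in>S. out_degree (path_edges (v0 # Pm i @ [vm i])) U u) \<ge> 1"
    if "v0 \<in> U" "vm i \<notin> U" "insert v0 (set (Pm i)) \<subseteq> S"
    using that assms(2) by (intro sum_path_out_degree_ge[of v0 _ U "vm i"]) auto
  show "(\<Sum>u\<in>S. out_degree (path_edges (v0 # Pp i @ [vp i])) U u) \<ge> 1"
    if "v0 \<in> U" "vp i \<notin> U" "insert v0 (set (Pp i)) \<subseteq> S"
    using that assms(2) by (intro sum_path_out_degree_ge[of v0 _ U "vp i"]) auto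
qed

text \<open>
  The cut is that of a weighted wheel: the six hubs form a cycle with weights 2 and 1 alternating,
  and each of them is joined to \<open>v0\<close> with weight 1.
\<close>

lemma region_cut_ge:
  assumes "i < 3" "v0 \<in> U"
  shows "(\<Sum>u\<in>verts G. out_degree (region_edges i) U u)
    \<ge> (if vm i \<in> U \<longleftrightarrow> vp i \<in> U then 0 else 2) + (if vm i \<in> U then 0 else 1)
      + (if vp i \<in> U then 0 else 1) + (if vp i \<in> U \<longleftrightarrow> vm ((i + 1) mod 3) \<in> U then 0 else 1)"
proof -
  let ?j = "(i + 1) mod 3" and ?o = "\<lambda>A. \<Sum>u\<in>verts G. out_degree A U u"
  have sub: "set (C i) \<subseteq> verts G" "insert v0 (set (Pm i)) \<subseteq> verts G"
    "insert v0 (set (Pp i)) \<subseteq> verts G"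
    using assms(1) unfolding verts_eq by auto
  have nonneg: "?o A \<ge> 0" for A
    by (intro sum_nonneg out_degree_nonneg)
  have "?o (cycle_edges (C i)) \<ge> (if vm i \<in> U \<longleftrightarrow> vp i \<in> U then 0 else 2)"
    using region_sum_out_degree_ge(1)[OF assms(1) finite_verts _ sub(1), of U] nonneg by simp
  moreover have "?o (path_edges (v0 # Pm i @ [vm i])) \<ge> (if vm i \<in> U then 0 else 1)"
    using region_sum_out_degree_ge(2)[OF assms(1) finite_verts assms(2) _ sub(2)] nonneg by simp
  moreover have "?o (path_edges (v0 # Pp i @ [vp i])) \<ge> (if vp i \<in> U then 0 else 1)"
    using region_sum_out_degree_ge(3)[OF assms(1) finite_verts assms(2) _ sub(3)] nonneg by simp
  moreover have "?o {#{vp i, vm ?j}#} \<ge> (if vp i \<in> U \<longleftrightarrow> vm ?j \<in> U then 0 else 1)"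
  proof (cases "vp i \<in> U \<longleftrightarrow> vm ?j \<in> U")
    case False
    have "{vp i, vm ?j} \<subseteq> verts G"
      using hubs_in_verts assms(1) by simp
    moreover obtain x w where "{x, w} = {vp i, vm ?j}" "x \<in> U" "w \<notin> U"
      using False by (cases "vp i \<in> U") auto
    ultimately have "?o (path_edges [vp i, vm ?j]) \<ge> 1"
      by (intro sum_path_out_degree_ge[of x _ U w]) auto
    then show ?thesis
      using False by simp
  qed (use nonneg in simp)
  ultimately show ?thesis
    unfolding out_degree_simps sum.distrib by linarith
qed

text \<open>The chips in the second alternative all lie outside \<open>C i\<close>. They pay for the
  two links and the two spokes at the hubs of \<open>C i\<close>, all of which \<open>U\<close>
  cuts.\<close>

lemma cycle_chips:
  assumes "i < 3" "R \<in> effective_divisors G" "div_degree G R \<le> 5"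
    and legal: "\<forall>q\<in>verts G. R q = 0 \<longrightarrow> (\<exists>U. U \<subseteq> verts G \<and> v0 \<in> U \<and> q \<notin> U \<and>
      (\<forall>u\<in>verts G. out_degree (edges G) U u \<le> R u))"
  shows "(\<Sum>u\<in>set (C i). R u) \<ge> 2 \<or> R (vp ((i + 2) mod 3)) \<ge> 1 \<and> R (vm ((i + 1) mod 3)) \<ge> 1 \<and>
    R v0 + (\<Sum>u\<in>set (Pm i). R u) + (\<Sum>u\<in>set (Pp i). R u) \<ge> 2"
proof (cases "(\<Sum>u\<in>set (C i). R u) \<ge> 2")
  case False
  let ?j = "(i + 1) mod 3" and ?k = "(i + 2) mod 3"
  have next_k: "(?k + 1) mod 3 = i" and next_j: "(?j + 1) mod 3 = ?k" and jk: "?j < 3" "?k < 3"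
    using assms(1) unfolding less_3_cases by auto
  have R: "R u \<ge> 0" for u
    using assms(2) by (simp add: effective_divisors_def)
  have "R (vm i) + R (vp i) \<le> (\<Sum>u\<in>set (C i). R u)"
    using sum_mono2[of "set (C i)" "{vm i, vp i}" R] hubs[OF assms(1)] R by simp
  then have "R (vm i) = 0 \<or> R (vp i) = 0"
    using R[of "vm i"] R[of "vp i"] False by linarith
  then obtain U where U: "U \<subseteq> verts G" "v0 \<in> U" "vm i \<notin> U \<or> vp i \<notin> U"
    "\<And>u. u \<in> verts G \<Longrightarrow> out_degree (edges G) U u \<le> R u"
    using legal hubs_in_verts[OF assms(1)] by metis
  \<comment> \<open>Legality, localized: the edges of any subgraph that leave \<open>U\<close> from
    \<open>S\<close> are bounded by the chips on \<open>S\<close>.\<close>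
  have chips: "(\<Sum>u\<in>S. out_degree A U u) \<le> (\<Sum>u\<in>S. R u)" if "S \<subseteq> verts G" "A \<subseteq># edges G" for S A
    using that U(4) by (intro sum_mono order_trans[OF out_degree_mono[OF that(2)]]) auto
  have sub: "cycle_edges (C i) \<subseteq># edges G"
    "path_edges (v0 # Pm i @ [vm i]) + path_edges (v0 # Pp i @ [vp i]) \<subseteq># edges G"
    "{#{vp i, vm ?j}#} \<subseteq># edges G"
    by (rule subset_mset.order_trans[OF _ region_edges_subset[OF assms(1)]],
        simp add: subseteq_mset_def)+
  \<comment> \<open>The link ending in \<open>vm i\<close> belongs to the region of the preceding
    cycle.\<close>
  have sub_k: "{#{vp ?k, vm i}#} \<subseteq># edges G"
    using region_edges_subset[OF jk(2)] unfolding next_k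
    by (rule subset_mset.order_trans[rotated]) (simp add: subseteq_mset_def)
  have i_verts: "set (C i) \<subseteq> verts G" "insert v0 (set (Pm i) \<union> set (Pp i)) \<subseteq> verts G"
    using assms(1) unfolding verts_eq by auto
  \<comment> \<open>Separating the hubs would take two chips on \<open>C i\<close>.\<close>
  have "vm i \<in> U \<longleftrightarrow> vp i \<in> U"
    using region_sum_out_degree_ge(1)[OF assms(1) finite_set, of U "C i"]
      chips[OF i_verts(1) sub(1)] False by fastforce
  then have i_notin: "vm i \<notin> U" "vp i \<notin> U"
    using U(3) by auto
  have cut: "(\<Sum>u\<in>verts G. out_degree (edges G) U u) \<le> 5"
    using chips[of "verts G" "edges G"] assms(3) by (simp add: div_degree_def)
  define f where "f n = (\<Sum>u\<in>verts G. out_degree (region_edges n) U u)" for n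
  have f: "f n \<ge> (if vm n \<in> U \<longleftrightarrow> vp n \<in> U then 0 else 2) + (if vm n \<in> U then 0 else 1)
      + (if vp n \<in> U then 0 else 1) + (if vp n \<in> U \<longleftrightarrow> vm ((n + 1) mod 3) \<in> U then 0 else 1)"
    if "n < 3" for n
    unfolding f_def by (rule region_cut_ge[OF that U(2)])
  have "(\<Sum>u\<in>verts G. out_degree (edges G) U u) = (\<Sum>n<3. f n)"
    unfolding edges_eq out_degree_sum f_def by (rule sum.swap)
  then have total: "f i + (f ?j + f ?k) \<le> 5"
    using cut sum_less_3_rotate[OF assms(1), of f] by linarith
  \<comment> \<open>The 2 comes from the two spokes of the cycle, both cut.\<close>
  have "f i \<ge> 2 + (if vm ?j \<in> U then 1 else 0)"
    using f[OF assms(1)] i_notin by (cases "vm ?j \<in> U") simp_all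
  moreover have "f ?k \<ge> (if vm ?k \<in> U \<longleftrightarrow> vp ?k \<in> U then 0 else 2) + (if vm ?k \<in> U then 0 else 1) + 1"
    using f[OF jk(2), unfolded next_k] i_notin by (cases "vp ?k \<in> U") simp_all
  ultimately have "2 + (if vm ?j \<in> U then 1 else 0)
      + ((if vm ?j \<in> U \<longleftrightarrow> vp ?j \<in> U then 0 else 2) + (if vm ?j \<in> U then 0 else 1)
      + (if vp ?j \<in> U then 0 else 1) + (if vp ?j \<in> U \<longleftrightarrow> vm ?k \<in> U then 0 else 1))
      + ((if vm ?k \<in> U \<longleftrightarrow> vp ?k \<in> U then 0 else 2) + (if vm ?k \<in> U then 0 else 1) + 1)
      \<le> (5 :: int)"
    using total f[OF jk(1), unfolded next_j] by linarith
  then have jk_in: "vm ?j \<in> U" "vp ?k \<in> U"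
    by (rule wheel_cut)+
  have one: "out_degree {#{x, w}#} U x = 1" if "x \<in> U" "w \<notin> U" for x w
    using that by (simp add: out_degree_def insert_Diff_if)
  \<comment> \<open>The link is a single edge, so the chip that pays for it must lie on the hub at
    its other end.\<close>
  have "out_degree {#{vp i, vm ?j}#} U (vm ?j) \<le> R (vm ?j)"
    by (rule order_trans[OF out_degree_mono[OF sub(3)] U(4)[OF hubs_in_verts(1)[OF jk(1)]]])
  then have "R (vm ?j) \<ge> 1"
    using one[OF jk_in(1) i_notin(2)] by (simp add: insert_commute)
  moreover have "out_degree {#{vp ?k, vm i}#} U (vp ?k) \<le> R (vp ?k)"
    by (rule order_trans[OF out_degree_mono[OF sub_k] U(4)[OF hubs_in_verts(2)[OF jk(2)]]])
  then have "R (vp ?k) \<ge> 1"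
    using one[OF jk_in(2) i_notin(1)] by simp
  moreover have "R v0 + (\<Sum>u\<in>set (Pm i). R u) + (\<Sum>u\<in>set (Pp i). R u) \<ge> 2"
  proof -
    \<comment> \<open>Leaving out the hubs keeps these chips separate from those counted on the
      cycles.\<close>
    let ?S = "insert v0 (set (Pm i) \<union> set (Pp i))"
    have "(\<Sum>u\<in>?S. out_degree (path_edges (v0 # Pm i @ [vm i])) U u) \<ge> 1"
      "(\<Sum>u\<in>?S. out_degree (path_edges (v0 # Pp i @ [vp i])) U u) \<ge> 1"
      using i_notin by (intro region_sum_out_degree_ge(2,3)[OF assms(1) _ U(2)]; auto)+
    then have "(\<Sum>u\<in>?S. R u) \<ge> 2"
      using chips[OF i_verts(2) sub(2)] by (simp only: out_degree_simps sum.distrib)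
    then show ?thesis
      using region_distinct[OF assms(1)] by (simp add: sum.union_disjoint)
  qed
  ultimately show ?thesis
    by blast
qed simp

lemma div_degree_regions:
  "div_degree G R
    = R v0 + (\<Sum>i<3. (\<Sum>u\<in>set (C i). R u) + (\<Sum>u\<in>set (Pm i). R u) + (\<Sum>u\<in>set (Pp i). R u))"
proof -
  have "div_degree G R = R v0 + (\<Sum>u\<in>(\<Union>i<3. set (C i @ Pm i @ Pp i)). R u)"
    unfolding div_degree_def verts_eq using region_distinct by (subst sum.insert[symmetric]) (auto simp: Un_assoc)
  also have "(\<Sum>u\<in>(\<Union>i<3. set (C i @ Pm i @ Pp i)). R u) = (\<Sum>i<3. \<Sum>u\<in>set (C i @ Pm i @ Pp i). R u)"
    by (rule sum.UNION_disjoint) (use region_disjoint in auto)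
  also have "\<dots> = (\<Sum>i<3. (\<Sum>u\<in>set (C i). R u) + (\<Sum>u\<in>set (Pm i). R u) + (\<Sum>u\<in>set (Pp i). R u))"
  proof (rule sum.cong)
    fix i
    assume "i \<in> {..<3::nat}"
    then show "(\<Sum>u\<in>set (C i @ Pm i @ Pp i). R u)
        = (\<Sum>u\<in>set (C i). R u) + (\<Sum>u\<in>set (Pm i). R u) + (\<Sum>u\<in>set (Pp i). R u)"
      using region_distinct[of i] by (simp add: sum.union_disjoint)
  qed simp
  finally show ?thesis .
qed

lemma degree_ge_6:
  assumes "D \<in> divisors G" "positive_rank G D"
  shows "div_degree G D \<ge> 6"
proof (rule ccontr)
  assume "\<not> ?thesis"
  then have deg: "div_degree G D \<le> 5"
    by simp
  obtain R where R: "R \<in> effective_divisors G" "div_degree G R = div_degree G D"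
    "\<forall>q\<in>verts G. R q = 0 \<longrightarrow> (\<exists>U. U \<subseteq> verts G \<and> v0 \<in> U \<and> q \<notin> U \<and>
      (\<forall>u\<in>verts G. out_degree (edges G) U u \<le> R u))"
    using positive_rank_legal_sets[OF assms(2,1)] .
  define c where "c i = (\<Sum>u\<in>set (C i). R u)" for i
  define p where "p i = (\<Sum>u\<in>set (Pm i). R u) + (\<Sum>u\<in>set (Pp i). R u)" for i
  have nonneg: "R u \<ge> 0" for u
    using R(1) by (simp add: effective_divisors_def)
  have p: "p i \<ge> 0" for i
    unfolding p_def by (intro add_nonneg_nonneg sum_nonneg nonneg)
  have c: "R (vm i) + R (vp i) \<le> c i" if "i < 3" for i
    using sum_mono2[of "set (C i)" "{vm i, vp i}" R] hubs[OF that] nonneg by (simp add: c_def)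
  have chips: "c i \<ge> 2 \<or> R (vp ((i + 2) mod 3)) \<ge> 1 \<and> R (vm ((i + 1) mod 3)) \<ge> 1 \<and> R v0 + p i \<ge> 2"
    if "i < 3" for i
    using cycle_chips[OF that R(1) _ R(3)] R(2) deg by (simp add: c_def p_def add.assoc)
  have "R v0 + (c 0 + p 0) + (c 1 + p 1) + (c 2 + p 2) \<le> 5"
    using div_degree_regions[of R] R(2) deg
    by (simp add: c_def p_def numeral_3_eq_3 numeral_2_eq_2 add.assoc)
  \<comment> \<open>Some cycle carries at most one chip, so \<open>v0\<close> and its spokes hold
    two and the cycles together at most three. Hence a second cycle carries at most one chip as
    well. The chips both of them demand put two on the third cycle and one on each of these two,
    which makes six in total.\<close>
  then show False
    using chips[of 0] chips[of 1] chips[of 2] c[of 0] c[of 1] c[of 2] p[of 0] p[of 1] p[of 2]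
      nonneg[of v0] nonneg[of "vm 0"] nonneg[of "vm 1"] nonneg[of "vm 2"]
      nonneg[of "vp 0"] nonneg[of "vp 1"] nonneg[of "vp 2"]
    by (simp add: numeral_2_eq_2) linarith
qed

subsection \<open>The upper bound\<close>

text \<open>A common index set for the six paths at \<open>v0\<close>: the cycle, and
  \<open>True\<close> for the end at \<open>vp\<close>, \<open>False\<close> for the end at
  \<open>vm\<close>.\<close>

definition spokes :: "(nat \<times> bool) set" where
  "spokes = {..<3} \<times> UNIV"

definition hub :: "nat \<times> bool \<Rightarrow> 'a" where
  "hub s = (if snd s then vp (fst s) else vm (fst s))"

definition spoke :: "nat \<times> bool \<Rightarrow> 'a list" where
  "spoke s = (if snd s then Pp (fst s) else Pm (fst s))"

lemma finite_spokes [simp]: "finite spokes"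
  by (simp add: spokes_def)

lemma card_spokes: "card spokes = 6"
  by (simp add: spokes_def card_cartesian_product)

lemma hub_in: "s \<in> spokes \<Longrightarrow> hub s \<in> set (C (fst s))"
  using hubs(1,2) by (auto simp: spokes_def hub_def)

lemma spoke_disjoint:
  assumes "s \<in> spokes" "t \<in> spokes" "s \<noteq> t"
  shows "set (spoke s) \<inter> set (spoke t) = {}"
proof (cases "fst s = fst t")
  case True
  then have "snd s \<noteq> snd t"
    using assms(3) by (simp add: prod_eq_iff)
  then show ?thesis
    using region_distinct[of "fst t"] assms True by (auto simp: spokes_def spoke_def)
next
  case False
  then show ?thesis
    using region_disjoint[of "fst s" "fst t"] assms by (auto simp: spokes_def spoke_def)
qed

lemma spoke_disjoint_cycle:
  assumes "s \<in> spokes" "i < 3"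
  shows "set (spoke s) \<inter> set (C i) = {}"
proof (cases "fst s = i")
  case True
  then show ?thesis
    using region_distinct[OF assms(2)] assms by (auto simp: spoke_def)
next
  case False
  then show ?thesis
    using region_disjoint[of "fst s" i] assms by (auto simp: spokes_def spoke_def)
qed

lemma v0_notin: "s \<in> spokes \<Longrightarrow> v0 \<notin> set (spoke s)" "i < 3 \<Longrightarrow> v0 \<notin> set (C i)"
  using region_distinct by (auto simp: spokes_def spoke_def)

lemma distinct_spoke: "s \<in> spokes \<Longrightarrow> distinct (spoke s)"
  using region_distinct by (auto simp: spokes_def spoke_def)

lemma hub_notin_spoke:
  assumes "s \<in> spokes" "t \<in> spokes"
  shows "hub s \<notin> set (spoke t)"
proof -
  have "fst s < 3"
    using assms(1) by (auto simp: spokes_def)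
  then show ?thesis
    using spoke_disjoint_cycle[OF assms(2)] hub_in[OF assms(1)] by blast
qed

lemma hub_neq_v0: "s \<in> spokes \<Longrightarrow> hub s \<noteq> v0"
  using v0_notin(2)[of "fst s"] hub_in[of s] by (auto simp: spokes_def)

lemma spoke_verts: "s \<in> spokes \<Longrightarrow> set (v0 # spoke s @ [hub s]) \<subseteq> verts G"
proof -
  assume s: "s \<in> spokes"
  then have "hub s \<in> verts G"
    using hubs_in_verts by (auto simp: spokes_def hub_def)
  moreover have "set (spoke s) \<subseteq> verts G"
    using s unfolding verts_eq by (auto simp: spokes_def spoke_def)
  ultimately show ?thesis
    by simp
qed

lemma edges_spokes:
  "edges G = (\<Sum>i<3. cycle_edges (C i) + {#{vp i, vm ((i + 1) mod 3)}#})
     + (\<Sum>s\<in>spokes. path_edges (v0 # spoke s @ [hub s]))"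
proof -
  have "(\<Sum>s\<in>spokes. path_edges (v0 # spoke s @ [hub s]))
      = (\<Sum>i<3. \<Sum>b\<in>UNIV. path_edges (v0 # spoke (i, b) @ [hub (i, b)]))"
    unfolding spokes_def by (simp add: sum.cartesian_product split_def)
  also have "\<dots> = (\<Sum>i<3. path_edges (v0 # Pm i @ [vm i]) + path_edges (v0 # Pp i @ [vp i]))"
    by (simp add: UNIV_bool spoke_def hub_def)
  finally show ?thesis
    unfolding edges_eq by (simp only: sum.distrib[symmetric] add.assoc)
qed

text \<open>Isolates a spoke in the form required by \<open>path_ends_cover\<close>: its inner
  vertices meet no other edges.\<close>

lemma edges_minus_spoke:
  assumes "s \<in> spokes"
  obtains R where "edges G = R + path_edges (v0 # spoke s @ [hub s])"
    "\<forall>e\<in>#R. e \<inter> set (spoke s) = {}"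
proof
  let ?R = "(\<Sum>i<3. cycle_edges (C i) + {#{vp i, vm ((i + 1) mod 3)}#})
     + (\<Sum>t\<in>spokes - {s}. path_edges (v0 # spoke t @ [hub t]))"
  show "edges G = ?R + path_edges (v0 # spoke s @ [hub s])"
    unfolding edges_spokes using sum.remove[OF finite_spokes assms] by (simp add: ac_simps)
  show "\<forall>e\<in>#?R. e \<inter> set (spoke s) = {}"
  proof
    fix e
    assume "e \<in># ?R"
    then consider i where "i < 3" "e \<in># cycle_edges (C i) + {#{vp i, vm ((i + 1) mod 3)}#}"
      | t where "t \<in> spokes" "t \<noteq> s" "e \<in># path_edges (v0 # spoke t @ [hub t])"
      by (auto simp: set_mset_sum)
    then show "e \<inter> set (spoke s) = {}"
    proof cases
      case 1
      have "set (C i @ [hd (C i)]) = set (C i)"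
        using hubs(1)[OF 1(1)] by (cases "C i") auto
      then have "e \<subseteq> set (C i) \<or> e = {vp i, vm ((i + 1) mod 3)}"
        using 1 path_edges_subset[of e "C i @ [hd (C i)]"] by (auto simp: cycle_edges_def)
      moreover have "vp i \<notin> set (spoke s)" "vm ((i + 1) mod 3) \<notin> set (spoke s)"
        using hub_notin_spoke[of "(i, True)" s] hub_notin_spoke[of "((i + 1) mod 3, False)" s] assms 1(1)
        by (auto simp: spokes_def hub_def)
      ultimately show ?thesis
        using spoke_disjoint_cycle[OF assms 1(1)] by auto
    next
      case 2
      then have "e \<subseteq> insert v0 (insert (hub t) (set (spoke t)))"
        using path_edges_subset[OF 2(3)] by auto
      then show ?thesis
        using spoke_disjoint[OF 2(1) assms 2(2)] v0_notin(1)[OF assms] hub_notin_spoke[OF 2(1) assms]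
        by blast
    qed
  qed
qed

lemma edges_minus_cycle:
  assumes "i < 3"
  obtains R where "edges G = R + cycle_edges (C i)"
    "\<forall>e\<in>#R. e \<inter> set (C i) \<subseteq> {vm i, vp i}"
proof
  let ?R = "(\<Sum>j\<in>{..<3} - {i}. cycle_edges (C j)) + (\<Sum>j<3. {#{vp j, vm ((j + 1) mod 3)}#})
     + (\<Sum>s\<in>spokes. path_edges (v0 # spoke s @ [hub s]))"
  have "(\<Sum>j<3. cycle_edges (C j)) = cycle_edges (C i) + (\<Sum>j\<in>{..<3} - {i}. cycle_edges (C j))"
    by (rule sum.remove) (use assms in auto)
  then show "edges G = ?R + cycle_edges (C i)"
    unfolding edges_spokes sum.distrib by (simp add: ac_simps)
  have hub_cycle: "hub s \<in> set (C i) \<Longrightarrow> hub s \<in> {vm i, vp i}" if "s \<in> spokes" for s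
  proof -
    assume "hub s \<in> set (C i)"
    moreover have "fst s < 3"
      using that by (auto simp: spokes_def)
    ultimately have "fst s = i"
      using hub_in[OF that] region_disjoint[of "fst s" i] assms by (cases "fst s = i") auto
    then show ?thesis
      by (simp add: hub_def)
  qed
  show "\<forall>e\<in>#?R. e \<inter> set (C i) \<subseteq> {vm i, vp i}"
  proof
    fix e
    assume "e \<in># ?R"
    then consider j where "j < 3" "j \<noteq> i" "e \<in># cycle_edges (C j)"
      | j where "j < 3" "e = {vp j, vm ((j + 1) mod 3)}"
      | s where "s \<in> spokes" "e \<in># path_edges (v0 # spoke s @ [hub s])"
      by (auto simp: set_mset_sum)
    then show "e \<inter> set (C i) \<subseteq> {vm i, vp i}"
    proof cases
      case 1
      have "set (C j @ [hd (C j)]) = set (C j)"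
        using hubs(1)[OF 1(1)] by (cases "C j") auto
      then have "e \<subseteq> set (C j)"
        using 1 path_edges_subset[of e "C j @ [hd (C j)]"] by (auto simp: cycle_edges_def)
      then show ?thesis
        using region_disjoint[OF 1(1) assms 1(2)] by auto
    next
      case 2
      then have "e = {hub (j, True), hub ((j + 1) mod 3, False)}"
        by (simp add: hub_def)
      moreover have "(j, True) \<in> spokes" "((j + 1) mod 3, False) \<in> spokes"
        using 2(1) by (auto simp: spokes_def)
      ultimately show ?thesis
        using hub_cycle by blast
    next
      case 3
      then have "e \<subseteq> insert v0 (insert (hub s) (set (spoke s)))"
        using path_edges_subset[OF 3(2)] by auto
      then show ?thesis
        using spoke_disjoint_cycle[OF 3(1) assms] v0_notin(2)[OF assms] hub_cycle[OF 3(1)] by blast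
    qed
  qed
qed

text \<open>The position after \<open>p\<close> steps from the hub towards \<open>v0\<close>. The
  hub has index \<open>Suc (length (spoke s))\<close>, and truncated subtraction leaves the chip at
  \<open>v0\<close> once it has arrived.\<close>

definition chip :: "nat \<Rightarrow> nat \<times> bool \<Rightarrow> 'a" where
  "chip p s = (v0 # spoke s @ [hub s]) ! (Suc (length (spoke s)) - p)"

text \<open>A sum over spokes, so that chips meeting at \<open>v0\<close> are counted with
  multiplicity.\<close>

definition spoke_chips :: "nat \<Rightarrow> 'a \<Rightarrow> int" where
  "spoke_chips p v = (\<Sum>s\<in>spokes. if v = chip p s then 1 else 0)"

lemma chip_0: "chip 0 s = hub s"
  by (simp add: chip_def nth_append)

lemma chip_in_path: "chip p s \<in> set (v0 # spoke s @ [hub s])"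
  unfolding chip_def by (rule nth_mem) simp

lemma spoke_chips_effective: "spoke_chips p \<in> effective_divisors G"
proof -
  have "chip p s \<in> verts G" if "s \<in> spokes" for s
    using chip_in_path spoke_verts[OF that] by blast
  then show ?thesis
    by (auto simp: effective_divisors_def divisors_def spoke_chips_def intro!: sum_nonneg sum.neutral)
qed

lemma spoke_chips_ge_1: "s \<in> spokes \<Longrightarrow> spoke_chips p (chip p s) \<ge> 1"
  using member_le_sum[of s spokes "\<lambda>t. if chip p s = chip p t then 1 else 0 :: int"]
  by (simp add: spoke_chips_def)

lemma div_degree_spoke_chips: "div_degree G (spoke_chips p) = 6"
proof -
  have "chip p s \<in> verts G" if "s \<in> spokes" for s
    using chip_in_path spoke_verts[OF that] by blast
  then have "(\<Sum>v\<in>verts G. if v = chip p s then 1 else 0 :: int) = 1" if "s \<in> spokes" for s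
    using that by simp
  then have "(\<Sum>s\<in>spokes. \<Sum>v\<in>verts G. if v = chip p s then 1 else 0 :: int) = 6"
    using card_spokes by simp
  then show ?thesis
    unfolding div_degree_def spoke_chips_def by (subst sum.swap)
qed

text \<open>Firing everything from the chips outwards moves each chip one step inwards. The bound on
  \<open>p\<close> says that no chip has reached \<open>v0\<close> yet.\<close>

lemma spoke_chips_step:
  assumes "\<And>s. s \<in> spokes \<Longrightarrow> p \<le> length (spoke s)"
  shows "div_equiv G (spoke_chips p) (spoke_chips (Suc p))"
proof -
  \<comment> \<open>The vertices that do not fire: \<open>v0\<close> and, on each spoke, those
    strictly between \<open>v0\<close> and the chip.\<close>
  define inner where
    "inner = insert v0 (\<Union>s\<in>spokes. set (take (length (spoke s) - p) (spoke s)))"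
  define y where "y v = (if v \<in> inner then 0 else 1 :: int)" for v
  have hub_y: "y (hub s) = 1" if "s \<in> spokes" for s
    using hub_notin_spoke[OF that] hub_neq_v0[OF that] by (auto simp: y_def inner_def dest: in_set_takeD)
  have cycle: "edges_laplacian (cycle_edges (C i)) y u = 0" if "i < 3" for i u
    unfolding cycle_edges_def
  proof (rule path_edges_laplacian_const)
    fix v
    assume "v \<in> set (C i @ [hd (C i)])"
    then have "v \<in> set (C i)"
      using hubs(1)[OF that] by (cases "C i") auto
    then show "y v = 1"
      using v0_notin(2)[OF that] spoke_disjoint_cycle[OF _ that]
      by (auto simp: y_def inner_def dest: in_set_takeD)
  qed
  have link: "edges_laplacian {#{vp i, vm ((i + 1) mod 3)}#} y u = 0" if "i < 3" for i u
    using hub_y[of "(i, True)"] hub_y[of "((i + 1) mod 3, False)"] that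
    by (simp add: spokes_def hub_def)
  have spoke: "edges_laplacian (path_edges (v0 # spoke s @ [hub s])) y u
      = (if u = chip p s then 1 else 0) - (if u = chip (Suc p) s then 1 else 0)"
    if s: "s \<in> spokes" for s u
  proof -
    let ?r = "length (spoke s) - p"
    let ?vs = "v0 # take ?r (spoke s)" and ?ws = "drop ?r (spoke s) @ [hub s]"
    have p: "p \<le> length (spoke s)"
      using assms[OF s] .
    have vs: "y v = 0" if "v \<in> set ?vs" for v
      using that s by (auto simp: y_def inner_def)
    have ws: "y v = 1" if "v \<in> set ?ws" for v
    proof (cases "v = hub s")
      case False
      then have v: "v \<in> set (drop ?r (spoke s))"
        using that by auto
      then have "v \<in> set (spoke s)"
        by (rule in_set_dropD)
      moreover have "v \<notin> set (take ?r (spoke s))"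
        using v set_take_disj_set_drop_if_distinct[OF distinct_spoke[OF s], of ?r ?r] by auto
      ultimately have "v \<notin> set (take (length (spoke t) - p) (spoke t))" if "t \<in> spokes" for t
        using spoke_disjoint[OF s that] by (cases "s = t") (auto dest: in_set_takeD)
      then have "v \<notin> inner"
        using v0_notin(1)[OF s] \<open>v \<in> set (spoke s)\<close> by (auto simp: inner_def)
      then show ?thesis
        by (simp add: y_def)
    qed (use hub_y[OF s] in simp)
    have path: "v0 # spoke s @ [hub s] = ?vs @ ?ws"
      by simp
    have last_inner: "chip (Suc p) s = last ?vs"
    proof (cases "?r = 0")
      case False
      then obtain x where x: "?r = Suc x"
        by (cases ?r) auto
      then have "x < length (spoke s)"
        by linarith
      then show ?thesis
        unfolding x by (simp add: chip_def x nth_append take_Suc_conv_app_nth)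
    qed (simp add: chip_def)
    have first_outer: "chip p s = hd ?ws"
      using p by (simp add: chip_def nth_append hd_append hd_drop_conv_nth Suc_diff_le)
    show ?thesis
      unfolding path last_inner first_outer
      by (rule path_edges_laplacian_step) (simp, simp, erule vs, erule ws)
  qed
  \<comment> \<open>Cycles and links lie where \<open>y\<close> is 1, so only the spokes
    contribute.\<close>
  have "edges_laplacian (edges G) y u = spoke_chips p u - spoke_chips (Suc p) u" for u
    unfolding edges_spokes edges_laplacian_simps edges_laplacian_sum spoke_chips_def
      sum_subtractf[symmetric]
    using cycle link spoke by simp
  then show ?thesis
    using div_equiv_iff[of "spoke_chips p" "spoke_chips (Suc p)"] spoke_chips_effective
      effective_in_divisors by metis
qed

lemma spoke_chips_equiv:
  assumes "\<And>s. s \<in> spokes \<Longrightarrow> p \<le> Suc (length (spoke s))"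
  shows "div_equiv G (spoke_chips 0) (spoke_chips p)"
  using assms
proof (induction p)
  case 0
  then show ?case
    using div_equiv_refl spoke_chips_effective effective_in_divisors by blast
next
  case (Suc p)
  have D: "spoke_chips n \<in> divisors G" for n
    by (rule effective_in_divisors[OF spoke_chips_effective])
  have "p \<le> length (spoke s)" if "s \<in> spokes" for s
    using Suc.prems[OF that] by simp
  then have "div_equiv G (spoke_chips p) (spoke_chips (Suc p))"
    by (rule spoke_chips_step)
  moreover have "div_equiv G (spoke_chips 0) (spoke_chips p)"
    using Suc by (simp add: Suc_leD)
  ultimately show ?case
    using div_equiv_trans[OF D D D] by blast
qed

text \<open>Both arcs have their ends at the hubs, which carry chips at the start; the arc not in
  use counts as the rest of the graph.\<close>

lemma spoke_chips_cover_cycle: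
  assumes "i < 3" "q \<in> set (C i)"
  shows "\<exists>F\<in>effective_divisors G. div_equiv G (spoke_chips 0) F \<and> F q \<ge> 1"
proof -
  have chips: "spoke_chips 0 (vm i) \<ge> 1" "spoke_chips 0 (vp i) \<ge> 1"
    using spoke_chips_ge_1[of "(i, False)" 0] spoke_chips_ge_1[of "(i, True)" 0] assms(1)
    by (simp_all add: chip_0 hub_def spokes_def)
  obtain xs ys where arcs:
    "cycle_edges (C i) = path_edges (vm i # xs @ [vp i]) + path_edges (vp i # ys @ [vm i])"
    "set (C i) = insert (vm i) (insert (vp i) (set xs \<union> set ys))"
    "distinct (vm i # vp i # xs @ ys)"
    using region_arcs[OF assms(1)] .
  obtain R where R: "edges G = R + cycle_edges (C i)"
    "\<forall>e\<in>#R. e \<inter> set (C i) \<subseteq> {vm i, vp i}"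
    using edges_minus_cycle[OF assms(1)] .
  have verts: "set (C i) \<subseteq> verts G"
    using assms(1) unfolding verts_eq by auto
  have sub: "e \<subseteq> insert a (insert b (set zs))" if "e \<in># path_edges (a # zs @ [b])" for e a b zs
    using path_edges_subset[OF that] by auto
  consider "q = vm i \<or> q = vp i" | "q \<in> set xs" | "q \<in> set ys"
    using assms(2) arcs(2) by blast
  then show ?thesis
  proof cases
    case 1
    then show ?thesis
      using chips spoke_chips_effective div_equiv_refl effective_in_divisors by blast
  next
    case 2
    show ?thesis
    proof (rule path_ends_cover)
      show "edges G = (R + path_edges (vp i # ys @ [vm i])) + path_edges (vm i # xs @ [vp i])"
        using R(1) arcs(1) by (simp add: ac_simps)
      show "e \<inter> set xs = {}" if "e \<in># R + path_edges (vp i # ys @ [vm i])" for e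
      proof -
        have "e \<inter> set (C i) \<subseteq> {vm i, vp i} \<or> e \<subseteq> insert (vp i) (insert (vm i) (set ys))"
          using that R(2) sub[of e "vp i" ys "vm i"] by (simp only: union_iff) blast
        then show ?thesis
          using arcs(2,3) by auto
      qed
    qed (use 2 arcs verts chips spoke_chips_effective in auto)
  next
    case 3
    show ?thesis
    proof (rule path_ends_cover)
      show "edges G = (R + path_edges (vm i # xs @ [vp i])) + path_edges (vp i # ys @ [vm i])"
        using R(1) arcs(1) by (simp add: ac_simps)
      show "e \<inter> set ys = {}" if "e \<in># R + path_edges (vm i # xs @ [vp i])" for e
      proof -
        have "e \<inter> set (C i) \<subseteq> {vm i, vp i} \<or> e \<subseteq> insert (vm i) (insert (vp i) (set xs))"
          using that R(2) sub[of e "vm i" xs "vp i"] by (simp only: union_iff) blast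
        then show ?thesis
          using arcs(2,3) by auto
      qed
    qed (use 3 arcs verts chips spoke_chips_effective in auto)
  qed
qed

lemma spoke_chips_cover_spoke:
  assumes "q \<in> verts G" "\<And>i. i < 3 \<Longrightarrow> q \<notin> set (C i)"
  shows "\<exists>F\<in>effective_divisors G. div_equiv G (spoke_chips 0) F \<and> F q \<ge> 1"
proof -
  \<comment> \<open>The number of steps after which the first chip, that on a shortest spoke,
    arrives at \<open>v0\<close>.\<close>
  let ?m = "Suc (Min ((\<lambda>s. length (spoke s)) ` spokes))"
  have "spokes \<noteq> {}"
    using card_spokes by auto
  then have "Min ((\<lambda>s. length (spoke s)) ` spokes) \<in> (\<lambda>s. length (spoke s)) ` spokes"
    by (intro Min_in) simp_all
  then obtain t where t: "t \<in> spokes" "?m = Suc (length (spoke t))"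
    by (metis (no_types, lifting) imageE)
  have m: "?m \<le> Suc (length (spoke s))" if "s \<in> spokes" for s
    using that by simp
  have D: "spoke_chips n \<in> divisors G" for n
    by (rule effective_in_divisors[OF spoke_chips_effective])
  have equiv: "div_equiv G (spoke_chips 0) (spoke_chips p)" if "p \<le> ?m" for p
    using order_trans[OF that m] by (rule spoke_chips_equiv)
  have root_chip: "spoke_chips ?m v0 \<ge> 1"
    using spoke_chips_ge_1[OF t(1), of ?m] unfolding t(2) by (simp add: chip_def)
  show ?thesis
  proof (cases "q = v0")
    case True
    then show ?thesis
      using root_chip equiv[OF order_refl] spoke_chips_effective by blast
  next
    case False
    then obtain i where i: "i < 3" "q \<in> set (Pm i) \<union> set (Pp i)"
      using assms unfolding verts_eq by blast
    then obtain s where s: "s \<in> spokes" "q \<in> set (spoke s)"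
      by (cases "q \<in> set (Pp i)")
         (auto simp: spokes_def spoke_def intro: that[of "(i, True)"] that[of "(i, False)"])
    then obtain r where r: "r < length (spoke s)" "q = spoke s ! r"
      by (metis in_set_conv_nth)
    show ?thesis
    \<comment> \<open>The distance of \<open>q\<close> from the hub: up to \<open>?m\<close>, the
      chip of this spoke passes \<open>q\<close> before or when the first chip arrives.\<close>
    proof (cases "length (spoke s) - r \<le> ?m")
      case True
      have "chip (length (spoke s) - r) s = q"
        using r by (simp add: chip_def nth_append Suc_diff_le)
      then show ?thesis
        using spoke_chips_ge_1[OF s(1)] equiv[OF True] spoke_chips_effective by blast
    next
      case False
      \<comment> \<open>The index within the spoke of its chip after \<open>?m\<close> steps. Now
        \<open>q\<close> lies between this chip and the one at \<open>v0\<close>, and these two are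
        moved towards each other.\<close>
      let ?l = "length (spoke s) - ?m"
      have l: "r < ?l" "?l < length (spoke s)"
        using False r(1) by auto
      let ?xs = "take ?l (spoke s)" and ?b = "spoke s ! ?l"
      let ?rest = "drop (Suc ?l) (spoke s) @ [hub s]"
      have path: "v0 # spoke s @ [hub s] = (v0 # ?xs) @ ?b # ?rest"
        using id_take_nth_drop[OF l(2)] by simp
      have b: "?b = chip ?m s"
        using l by (simp add: chip_def nth_append Suc_diff_le)
      have "distinct (?xs @ ?b # drop (Suc ?l) (spoke s))"
        using distinct_spoke[OF s(1)] id_take_nth_drop[OF l(2)] by metis
      then have disj: "?b \<notin> set ?xs" "set ?rest \<inter> set ?xs = {}"
        using hub_notin_spoke[OF s(1) s(1)] by (auto dest: in_set_takeD)
      obtain R where R: "edges G = R + path_edges (v0 # spoke s @ [hub s])"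
        "\<forall>e\<in>#R. e \<inter> set (spoke s) = {}"
        using edges_minus_spoke[OF s(1)] .
      have "\<exists>F\<in>effective_divisors G. div_equiv G (spoke_chips ?m) F \<and> 1 \<le> F q"
      proof (rule path_ends_cover)
        show "edges G = (R + path_edges (?b # ?rest)) + path_edges (v0 # ?xs @ [?b])"
        proof -
          have "path_edges (v0 # spoke s @ [hub s]) = path_edges (v0 # ?xs @ [?b]) + path_edges (?b # ?rest)"
            unfolding path by (subst path_edges_append) simp
          then show ?thesis
            using R(1) by (simp only: ac_simps)
        qed
        show "e \<inter> set ?xs = {}" if "e \<in># R + path_edges (?b # ?rest)" for e
        proof -
          have "e \<inter> set (spoke s) = {} \<or> e \<subseteq> insert ?b (set ?rest)"
            using that R(2) path_edges_subset[of e "?b # ?rest"]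
            by (simp only: union_iff list.set(2)) blast
          then show ?thesis
            using disj set_take_subset[of ?l "spoke s"] by blast
        qed
        show "q \<in> set ?xs"
          using r l by (auto simp: in_set_conv_nth intro!: exI[of _ r])
        show "spoke_chips ?m ?b \<ge> 1"
          unfolding b by (rule spoke_chips_ge_1[OF s(1)])
        have "?b \<in> set (spoke s)"
          using l(2) by (rule nth_mem)
        then show "v0 \<noteq> ?b" "insert v0 (insert ?b (set ?xs)) \<subseteq> verts G"
          using v0_notin(1)[OF s(1)] spoke_verts[OF s(1)] by (auto dest: in_set_takeD)
        show "v0 \<notin> set ?xs"
          using v0_notin(1)[OF s(1)] by (auto dest: in_set_takeD)
      qed (use root_chip disj distinct_spoke[OF s(1)] spoke_chips_effective in auto)
      then obtain F where F: "F \<in> effective_divisors G" "div_equiv G (spoke_chips ?m) F" "F q \<ge> 1"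
        by blast
      then show ?thesis
        using div_equiv_trans[OF D D effective_in_divisors[OF F(1)] equiv[OF order_refl] F(2)] by blast
    qed
  qed
qed

lemma positive_rank_spoke_chips: "positive_rank G (spoke_chips 0)"
proof (rule positive_rankI[OF effective_in_divisors[OF spoke_chips_effective]])
  fix q
  assume "q \<in> verts G"
  then show "\<exists>F\<in>effective_divisors G. div_equiv G (spoke_chips 0) F \<and> F q \<ge> 1"
    using spoke_chips_cover_cycle spoke_chips_cover_spoke by blast
qed

section \<open>From positive rank to rank and gonality\<close>

abbreviation rank_at_least :: "('a \<Rightarrow> int) \<Rightarrow> int \<Rightarrow> bool" where
  "rank_at_least D k \<equiv> \<forall>E \<in> effective_divisors G. div_degree G E = k \<longrightarrow>
        (\<exists>F \<in> effective_divisors G. div_equiv G (\<lambda>v. D v - E v) F)"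

lemma rank_at_least_neg: "rank_at_least D (-1)"
proof (intro ballI impI)
  fix E
  assume E: "E \<in> effective_divisors G" "div_degree G E = -1"
  have "div_degree G E \<ge> 0"
    using E(1) by (auto simp: div_degree_def effective_divisors_def intro!: sum_nonneg)
  then show "\<exists>F \<in> effective_divisors G. div_equiv G (\<lambda>v. D v - E v) F"
    using E(2) by simp
qed

text \<open>Subtracting \<open>k - 1\<close> chips at \<open>v0\<close> lowers the rank by at most \<open>k - 1\<close>.\<close>

lemma rank_at_least_degree:
  assumes "D \<in> divisors G" "k \<ge> 1" "rank_at_least D k"
  shows "div_degree G D \<ge> 5 + k"
proof -
  let ?P = "\<lambda>v. if v = v0 then k - 1 else 0"
  let ?D = "\<lambda>v. D v - ?P v"
  have P: "?P \<in> effective_divisors G" "div_degree G ?P = k - 1"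
    using point_divisor[OF finite_verts root, of "k - 1"] assms(2) by auto
  have "positive_rank G ?D"
    unfolding positive_rank_def
  proof (intro ballI impI)
    fix E
    assume E: "E \<in> effective_divisors G" "div_degree G E = 1"
    let ?E = "\<lambda>v. ?P v + E v"
    have "?E \<in> effective_divisors G"
      using E(1) P(1) unfolding effective_divisors_def divisors_def by simp
    moreover have "div_degree G ?E = k"
      using E(2) P(2) unfolding div_degree_def sum.distrib by simp
    ultimately obtain F where "F \<in> effective_divisors G" "div_equiv G (\<lambda>v. D v - ?E v) F"
      using assms(3) by blast
    moreover have "(\<lambda>v. D v - ?E v) = (\<lambda>v. ?D v - E v)"
      by (rule ext) simp
    ultimately show "\<exists>F \<in> effective_divisors G. div_equiv G (\<lambda>v. ?D v - E v) F"
      by auto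
  qed
  moreover have "?D \<in> divisors G"
    using assms(1) by (simp add: divisors_def)
  ultimately have "div_degree G ?D \<ge> 6"
    by (intro degree_ge_6)
  moreover have "div_degree G ?D = div_degree G D - (k - 1)"
    using P(2) unfolding div_degree_def sum_subtractf by simp
  ultimately show ?thesis
    by simp
qed

text \<open>A larger \<open>k\<close> would require degree at least \<open>5 + k\<close>, which
  exceeds 6.\<close>

lemma div_rank_spoke_chips: "div_rank G (spoke_chips 0) = 1"
  unfolding div_rank_def
proof (rule Greatest_equality)
  show "rank_at_least (spoke_chips 0) 1"
    using positive_rank_spoke_chips unfolding positive_rank_def .
  show "k \<le> 1" if "rank_at_least (spoke_chips 0) k" for k
    using rank_at_least_degree[OF effective_in_divisors[OF spoke_chips_effective] _ that]
      div_degree_spoke_chips[of 0] by (cases "k \<ge> 1") simp_all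
qed

text \<open>The value of a \<open>GREATEST\<close> yields its property only if the maximum is
  attained, so the argument goes by contraposition: below degree 6 no \<open>k\<close> from 1 on
  qualifies, and the maximum exists and is at most 0.\<close>

lemma degree_ge_6_of_div_rank:
  assumes "D \<in> divisors G" "div_rank G D = 1"
  shows "div_degree G D \<ge> 6"
proof (rule ccontr)
  assume deg: "\<not> ?thesis"
  have "div_rank G D \<le> 0"
    unfolding div_rank_def
  proof (rule int_Greatest_le)
    show "k \<le> 0" if "rank_at_least D k" for k
      using rank_at_least_degree[OF assms(1) _ that] deg by (cases "k \<ge> 1") simp_all
  qed (rule rank_at_least_neg)
  then show False
    using assms(2) by simp
qed

lemma dgon_eq_6: "dgon G = 6"
  unfolding dgon_def
proof (rule Least_equality)
  show "\<exists>D\<in>divisors G. div_rank G D = 1 \<and> div_degree G D = 6"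
    using div_rank_spoke_chips div_degree_spoke_chips effective_in_divisors[OF spoke_chips_effective]
    by blast
  show "6 \<le> d" if "\<exists>D\<in>divisors G. div_rank G D = 1 \<and> div_degree G D = d" for d
    using that degree_ge_6_of_div_rank by blast
qed

end

theorem theorem4p8:
  fixes G :: "'a multigraph"
  assumes "tricycle_graph G"
  shows "dgon G = 6"
proof -
  obtain v0 C vm vp Pm Pp where G:
    "\<forall>i<3. length (C i) \<ge> 2 \<and> vm i \<in> set (C i) \<and> vp i \<in> set (C i) \<and> vm i \<noteq> vp i
               \<and> Pm i \<noteq> [] \<and> Pp i \<noteq> []"
    "distinct (v0 # concat (map (\<lambda>i. C i @ Pm i @ Pp i) [0..<3]))"
    "verts G = insert v0 (\<Union>i<3. set (C i) \<union> set (Pm i) \<union> set (Pp i))"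
    "edges G = (\<Sum>i<3. cycle_edges (C i) + {#{vp i, vm ((i + 1) mod 3)}#}
                 + path_edges (v0 # Pm i @ [vm i]) + path_edges (v0 # Pp i @ [vp i]))"
    using assms unfolding tricycle_graph_def by blast
  interpret tricycle G v0 C vm vp Pm Pp
    by unfold_locales (use G in auto)
  show ?thesis
    by (rule dgon_eq_6)
qed

end
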